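(* Let $(A,X,\psi)$ be a cowreath in a strict monoidal category $\mathcal C$. Let $F:\mathcal C(\psi)_A^X\to\mathcal C_A$ be the forgetful functor from entwined modules to right $A$-modules and let $G:\mathcal C_A\to\mathcal C(\psi)_A^X$ be its right adjoint, given by $G(N)=NX$. If $\underline 1$ is a left $\otimes$-generator for $\mathcal C$, then there is an isomorphism (bijection) $$\mathrm{Nat}(\mathrm{Id}_{\mathcal C_A},FG)\cong\mathcal T_A^\#(\underline 1,X),$$ where $\mathcal T_A^\#(\underline 1,X)$ denotes the set of morphisms $\underline 1\to (X,\psi)$ in $\mathcal T_A^\#$.
   Context: Conventions: $\mathcal C$ is a strict monoidal category with unit object $\underline 1$; the tensor product is written by juxtaposition, and the identity morphism of $X$ is written $X$ (so $fA=f\otimes \mathrm{Id}_A$). $(A,m,\eta)$ is an algebra in $\mathcal C$; $\mathcal C_A$ is the category of right $A$-modules $(N,\mu:NA\to N)$. Left $\otimes$-generator: $P\in\mathcal C$ is a left $\otimes$-generator if for all $f,g:YZ\to W$ in $\mathcal C$: if $f\circ hZ=g\circ hZ$ for all $h:P\to Y$, then $f=g$. Transfer morphisms: $\mathcal T_A^\#$ has as objects the pairs $(X,\psi)$, $\psi:XA\to AX$ with $\psi\circ Xm=mX\circ A\psi\circ\psi A$ and $\psi\circ X\eta=\eta X$. A morphism $(X,\psi_X)\to(Y,\psi_Y)$ is $f:X\to AY$ in $\mathcal C$ with $mY\circ Af\circ\psi_X=mY\circ A\psi_Y\circ fA$; composition $g\bullet f=mZ\circ Ag\circ f$, identity $\eta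 X$; tensor product of objects $(XY,\psi_XY\circ X\psi_Y)$, of morphisms $f:X\to AX'$, $g:Y\to AY'$: $mX'Y'\circ A\psi_{X'}Y'\circ fg$; unit object $(\underline 1,A)$. In particular, $\mathcal T_A^\#(\underline 1,X)$ consists of the $t:\underline 1\to AX$ in $\mathcal C$ with $mX\circ At=mX\circ A\psi\circ tA$. Cowreath: $(A,X,\psi)$ with $(X,\psi)$ a coalgebra in $\mathcal T_A^\#$; explicitly there are $\delta:X\to AXX$, $\epsilon:X\to A$ with $mXX\circ A\psi X\circ AX\psi\circ\delta A=mXX\circ A\delta\circ\psi$; $mXXX\circ A\delta X\circ\delta=mXXX\circ A\psi XX\circ AX\delta\circ\delta$; $m\circ A\epsilon\circ\psi=m\circ\epsilon A$; $mX\circ A\epsilon X\circ\delta=\eta X=mX\circ A\psi\circ AX\epsilon\circ\delta$. Entwined modules: objects of $\mathcal C(\psi)_A^X$ are $(M,\mu,\rho)$ with $(M,\mu)\in\mathcal C_A$, $\rho:M\to MX$, $\rho\circ\mu=\mu X\circ M\psi\circ\rho A$, $\rho X\circ\rho=\mu XX\circ M\delta\circ\rho$, $\mu\circ M\epsilon\circ\rho=M$. Morphisms are right $A$-linear $f$ with $fX\circ\rho=\rho\circ f$. The right adjoint $G$ of $F$: $G(N)=NX$ with action $\mu X\circ N\psi$ and coaction $\mu XX\circ N\delta$; $G(f)=fX$. *)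

theory Defs
  imports "HOL-Library.FuncSet"
begin

section \<open>Categories, functors, natural transformations\<close>

record ('o, 'm) cat =
  Obj :: "'o set"
  Arr :: "'m set"
  Dom :: "'m \<Rightarrow> 'o"
  Cod :: "'m \<Rightarrow> 'o"
  Ide :: "'o \<Rightarrow> 'm"  ("\<iota>\<index>")
  Comp :: "'m \<Rightarrow> 'm \<Rightarrow> 'm"  (infixr "\<cdot>\<index>" 70)

definition hom :: "('o, 'm, 'z) cat_scheme \<Rightarrow> 'o \<Rightarrow> 'o \<Rightarrow> 'm set" where
  "hom C X Y = {f \<in> Arr C. Dom C f = X \<and> Cod C f = Y}"

locale category =
  fixes C :: "('o, 'm, 'z) cat_scheme" (structure)
  assumes Dom_Obj: "f \<in> Arr C \<Longrightarrow> Dom C f \<in> Obj C"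
    and Cod_Obj: "f \<in> Arr C \<Longrightarrow> Cod C f \<in> Obj C"
    and Ide_hom: "X \<in> Obj C \<Longrightarrow> \<iota> X \<in> hom C X X"
    and Comp_hom: "\<lbrakk>f \<in> hom C X Y; g \<in> hom C Y Z\<rbrakk> \<Longrightarrow> g \<cdot> f \<in> hom C X Z"
    and Ide_left: "f \<in> hom C X Y \<Longrightarrow> \<iota> Y \<cdot> f = f"
    and Ide_right: "f \<in> hom C X Y \<Longrightarrow> f \<cdot> \<iota> X = f"
    and Comp_assoc: "\<lbrakk>f \<in> hom C W X; g \<in> hom C X Y; h \<in> hom C Y Z\<rbrakk>
      \<Longrightarrow> (h \<cdot> g) \<cdot> f = h \<cdot> (g \<cdot> f)"

record ('o, 'm, 'p, 'n) func =
  FO :: "'o \<Rightarrow> 'p"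
  FM :: "'m \<Rightarrow> 'n"

locale cat_functor = source: category C + target: category D
  for C :: "('o, 'm, 'y) cat_scheme" and D :: "('p, 'n, 'z) cat_scheme" +
  fixes F :: "('o, 'm, 'p, 'n) func"
  assumes FO_Obj: "X \<in> Obj C \<Longrightarrow> FO F X \<in> Obj D"
    and FM_hom: "f \<in> hom C X Y \<Longrightarrow> FM F f \<in> hom D (FO F X) (FO F Y)"
    and FM_Ide: "X \<in> Obj C \<Longrightarrow> FM F (Ide C X) = Ide D (FO F X)"
    and FM_Comp: "\<lbrakk>f \<in> hom C X Y; g \<in> hom C Y Z\<rbrakk>
      \<Longrightarrow> FM F (Comp C g f) = Comp D (FM F g) (FM F f)"

definition id_func :: "('o, 'm, 'o, 'm) func" where
  "id_func = \<lparr>FO = (\<lambda>X. X), FM = (\<lambda>f. f)\<rparr>"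

definition comp_func ::
    "('p, 'n, 'q, 'k) func \<Rightarrow> ('o, 'm, 'p, 'n) func \<Rightarrow> ('o, 'm, 'q, 'k) func"
    (infixr "\<circ>\<^sub>F" 55) where
  "G \<circ>\<^sub>F F = \<lparr>FO = FO G \<circ> FO F, FM = FM G \<circ> FM F\<rparr>"

text \<open>Families of components are required to be \<^const>\<open>undefined\<close> off the objects of the source
  category, so that each natural transformation is represented exactly once.\<close>

definition Nat_Trans :: "('o, 'm, 'y) cat_scheme \<Rightarrow> ('p, 'n, 'z) cat_scheme
    \<Rightarrow> ('o, 'm, 'p, 'n) func \<Rightarrow> ('o, 'm, 'p, 'n) func \<Rightarrow> ('o \<Rightarrow> 'n) set" where
  "Nat_Trans C D F G = {\<theta> \<in> extensional (Obj C).
     (\<forall>X \<in> Obj C. \<theta> X \<in> hom D (FO F X) (FO G X)) \<and>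
     (\<forall>X \<in> Obj C. \<forall>Y \<in> Obj C. \<forall>f \<in> hom C X Y.
        Comp D (\<theta> Y) (FM F f) = Comp D (FM G f) (\<theta> X))}"

text \<open>\<open>F : C \<rightarrow> D\<close> is left adjoint to \<open>G : D \<rightarrow> C\<close>, by unit, counit and triangle identities.\<close>

definition adjoint :: "('o, 'm, 'y) cat_scheme \<Rightarrow> ('p, 'n, 'z) cat_scheme
    \<Rightarrow> ('o, 'm, 'p, 'n) func \<Rightarrow> ('p, 'n, 'o, 'm) func \<Rightarrow> bool" where
  "adjoint C D F G \<longleftrightarrow> cat_functor C D F \<and> cat_functor D C G \<and>
     (\<exists>u \<in> Nat_Trans C C id_func (G \<circ>\<^sub>F F). \<exists>c \<in> Nat_Trans D D (F \<circ>\<^sub>F G) id_func.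
        (\<forall>X \<in> Obj C. Comp D (c (FO F X)) (FM F (u X)) = Ide D (FO F X)) \<and>
        (\<forall>Y \<in> Obj D. Comp C (FM G (c Y)) (u (FO G Y)) = Ide C (FO G Y)))"

text \<open>A category given by its hom-sets, which need not be disjoint: an arrow is a triple
  (source, morphism, target). The composition law \<open>c Z g f\<close> may depend on the target \<open>Z\<close>
  of \<open>g\<close>.\<close>

definition cat_of_homs :: "'o set \<Rightarrow> ('o \<Rightarrow> 'o \<Rightarrow> 'm set) \<Rightarrow> ('o \<Rightarrow> 'm)
    \<Rightarrow> ('o \<Rightarrow> 'm \<Rightarrow> 'm \<Rightarrow> 'm) \<Rightarrow> ('o, 'o \<times> 'm \<times> 'o) cat" where
  "cat_of_homs Ob H i c = \<lparr>
     Obj = Ob,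
     Arr = {(X, f, Y). X \<in> Ob \<and> Y \<in> Ob \<and> f \<in> H X Y},
     Dom = (\<lambda>(X, f, Y). X),
     Cod = (\<lambda>(X, f, Y). Y),
     Ide = (\<lambda>X. (X, i X, X)),
     Comp = (\<lambda>(_, g, Z) (X, f, _). (X, c Z g f, Z))\<rparr>"


section \<open>Strict monoidal categories\<close>

record ('o, 'm) moncat = "('o, 'm) cat" +
  Unit :: 'o  ("\<one>\<index>")
  TensO :: "'o \<Rightarrow> 'o \<Rightarrow> 'o"  (infixr "\<odot>\<index>" 75)
  TensM :: "'m \<Rightarrow> 'm \<Rightarrow> 'm"  (infixr "\<otimes>\<index>" 75)

locale strict_monoidal_category = category C
  for C :: "('o, 'm, 'z) moncat_scheme" (structure) +
  assumes Unit_Obj: "\<one> \<in> Obj C"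
    and TensO_Obj: "\<lbrakk>X \<in> Obj C; Y \<in> Obj C\<rbrakk> \<Longrightarrow> X \<odot> Y \<in> Obj C"
    and TensM_hom: "\<lbrakk>f \<in> hom C X X'; g \<in> hom C Y Y'\<rbrakk>
      \<Longrightarrow> f \<otimes> g \<in> hom C (X \<odot> Y) (X' \<odot> Y')"
    and TensM_Ide: "\<lbrakk>X \<in> Obj C; Y \<in> Obj C\<rbrakk> \<Longrightarrow> \<iota> X \<otimes> \<iota> Y = \<iota> (X \<odot> Y)"
    and TensM_Comp: "\<lbrakk>f \<in> hom C X X'; f' \<in> hom C X' X''; g \<in> hom C Y Y'; g' \<in> hom C Y' Y''\<rbrakk>
      \<Longrightarrow> (f' \<cdot> f) \<otimes> (g' \<cdot> g) = (f' \<otimes> g') \<cdot> (f \<otimes> g)"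
    and TensO_assoc: "\<lbrakk>X \<in> Obj C; Y \<in> Obj C; Z \<in> Obj C\<rbrakk> \<Longrightarrow> (X \<odot> Y) \<odot> Z = X \<odot> (Y \<odot> Z)"
    and TensO_Unit_left: "X \<in> Obj C \<Longrightarrow> \<one> \<odot> X = X"
    and TensO_Unit_right: "X \<in> Obj C \<Longrightarrow> X \<odot> \<one> = X"
    and TensM_assoc: "\<lbrakk>f \<in> Arr C; g \<in> Arr C; h \<in> Arr C\<rbrakk>
      \<Longrightarrow> (f \<otimes> g) \<otimes> h = f \<otimes> (g \<otimes> h)"
    and TensM_Unit_left: "f \<in> Arr C \<Longrightarrow> \<iota> \<one> \<otimes> f = f"
    and TensM_Unit_right: "f \<in> Arr C \<Longrightarrow> f \<otimes> \<iota> \<one> = f"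

context
  fixes C :: "('o, 'm, 'z) moncat_scheme" (structure)
begin

definition algebra :: "'o \<Rightarrow> 'm \<Rightarrow> 'm \<Rightarrow> bool" where
  "algebra A m \<eta> \<longleftrightarrow> A \<in> Obj C \<and> m \<in> hom C (A \<odot> A) A \<and> \<eta> \<in> hom C \<one> A \<and>
     m \<cdot> (m \<otimes> \<iota> A) = m \<cdot> (\<iota> A \<otimes> m) \<and>
     m \<cdot> (\<eta> \<otimes> \<iota> A) = \<iota> A \<and> m \<cdot> (\<iota> A \<otimes> \<eta>) = \<iota> A"

definition coalgebra :: "'o \<Rightarrow> 'm \<Rightarrow> 'm \<Rightarrow> bool" where
  "coalgebra X \<delta> \<epsilon> \<longleftrightarrow> X \<in> Obj C \<and> \<delta> \<in> hom C X (X \<odot> X) \<and> \<epsilon> \<in> hom C X \<one> \<and>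
     (\<delta> \<otimes> \<iota> X) \<cdot> \<delta> = (\<iota> X \<otimes> \<delta>) \<cdot> \<delta> \<and>
     (\<epsilon> \<otimes> \<iota> X) \<cdot> \<delta> = \<iota> X \<and> (\<iota> X \<otimes> \<epsilon>) \<cdot> \<delta> = \<iota> X"

definition left_tensor_generator :: "'o \<Rightarrow> bool" where
  "left_tensor_generator P \<longleftrightarrow> P \<in> Obj C \<and>
     (\<forall>Y \<in> Obj C. \<forall>Z \<in> Obj C. \<forall>W \<in> Obj C. \<forall>f \<in> hom C (Y \<odot> Z) W. \<forall>g \<in> hom C (Y \<odot> Z) W.
        (\<forall>h \<in> hom C P Y. f \<cdot> (h \<otimes> \<iota> Z) = g \<cdot> (h \<otimes> \<iota> Z)) \<longrightarrow> f = g)"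

definition right_modules :: "'o \<Rightarrow> 'm \<Rightarrow> 'm \<Rightarrow> ('o \<times> 'm) set" where
  "right_modules A m \<eta> = {(N, \<mu>). N \<in> Obj C \<and> \<mu> \<in> hom C (N \<odot> A) N \<and>
     \<mu> \<cdot> (\<mu> \<otimes> \<iota> A) = \<mu> \<cdot> (\<iota> N \<otimes> m) \<and> \<mu> \<cdot> (\<iota> N \<otimes> \<eta>) = \<iota> N}"

definition right_linear :: "'o \<Rightarrow> 'o \<times> 'm \<Rightarrow> 'o \<times> 'm \<Rightarrow> 'm set" where
  "right_linear A = (\<lambda>(M, \<mu>) (N, \<nu>). {f \<in> hom C M N. f \<cdot> \<mu> = \<nu> \<cdot> (f \<otimes> \<iota> A)})"

definition module_cat ::
    "'o \<Rightarrow> 'm \<Rightarrow> 'm \<Rightarrow> ('o \<times> 'm, ('o \<times> 'm) \<times> 'm \<times> ('o \<times> 'm)) cat" where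
  "module_cat A m \<eta> = cat_of_homs (right_modules A m \<eta>) (right_linear A)
     (\<lambda>(N, \<mu>). \<iota> N) (\<lambda>_ g f. g \<cdot> f)"


section \<open>Transfer morphisms and cowreaths\<close>

definition transfer_objs :: "'o \<Rightarrow> 'm \<Rightarrow> 'm \<Rightarrow> ('o \<times> 'm) set" where
  "transfer_objs A m \<eta> = {(X, \<psi>). X \<in> Obj C \<and> \<psi> \<in> hom C (X \<odot> A) (A \<odot> X) \<and>
     \<psi> \<cdot> (\<iota> X \<otimes> m) = (m \<otimes> \<iota> X) \<cdot> (\<iota> A \<otimes> \<psi>) \<cdot> (\<psi> \<otimes> \<iota> A) \<and>
     \<psi> \<cdot> (\<iota> X \<otimes> \<eta>) = \<eta> \<otimes> \<iota> X}"

definition transfer_homs :: "'o \<Rightarrow> 'm \<Rightarrow> 'o \<times> 'm \<Rightarrow> 'o \<times> 'm \<Rightarrow> 'm set" where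
  "transfer_homs A m = (\<lambda>(X, \<psi>) (Y, \<phi>). {f \<in> hom C X (A \<odot> Y).
     (m \<otimes> \<iota> Y) \<cdot> (\<iota> A \<otimes> f) \<cdot> \<psi> = (m \<otimes> \<iota> Y) \<cdot> (\<iota> A \<otimes> \<phi>) \<cdot> (f \<otimes> \<iota> A)})"

definition transfer_cat ::
    "'o \<Rightarrow> 'm \<Rightarrow> 'm \<Rightarrow> ('o \<times> 'm, ('o \<times> 'm) \<times> 'm \<times> ('o \<times> 'm)) moncat" where
  "transfer_cat A m \<eta> =
     (let tens = (\<lambda>(X, \<psi>) (Y, \<phi>). (X \<odot> Y, (\<psi> \<otimes> \<iota> Y) \<cdot> (\<iota> X \<otimes> \<phi>)))
      in cat.extend
        (cat_of_homs (transfer_objs A m \<eta>) (transfer_homs A m)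
          (\<lambda>(X, \<psi>). \<eta> \<otimes> \<iota> X)
          (\<lambda>(Z, _) g f. (m \<otimes> \<iota> Z) \<cdot> (\<iota> A \<otimes> g) \<cdot> f))
        (moncat.fields
          (\<one>, \<iota> A)
          tens
          (\<lambda>(S, f, (X', \<psi>')) (T, g, (Y', \<phi>')).
             (tens S T,
              (m \<otimes> \<iota> X' \<otimes> \<iota> Y') \<cdot> (\<iota> A \<otimes> \<psi>' \<otimes> \<iota> Y') \<cdot> (f \<otimes> g),
              tens (X', \<psi>') (Y', \<phi>')))))"

end

text \<open>The morphisms \<open>\<delta> : X \<rightarrow> AXX\<close> and \<open>\<epsilon> : X \<rightarrow> A\<close> of \<open>C\<close> become arrows of the transfer
  category once decorated with source and target; see \<open>cowreath_iff\<close> for the explicit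
  equations.\<close>

definition cowreath :: "('o, 'm, 'z) moncat_scheme \<Rightarrow> 'o \<Rightarrow> 'm \<Rightarrow> 'm
    \<Rightarrow> 'o \<Rightarrow> 'm \<Rightarrow> 'm \<Rightarrow> 'm \<Rightarrow> bool" where
  "cowreath C A m \<eta> X \<psi> \<delta> \<epsilon> \<longleftrightarrow> algebra C A m \<eta> \<and>
     (let T = transfer_cat C A m \<eta>
      in coalgebra T (X, \<psi>)
           ((X, \<psi>), \<delta>, TensO T (X, \<psi>) (X, \<psi>))
           ((X, \<psi>), \<epsilon>, Unit T))"


section \<open>Entwined modules\<close>

context
  fixes C :: "('o, 'm, 'z) moncat_scheme" (structure)
begin

definition entwined_modules :: "'o \<Rightarrow> 'm \<Rightarrow> 'm \<Rightarrow> 'o \<Rightarrow> 'm \<Rightarrow> 'm \<Rightarrow> 'm \<Rightarrow> ('o \<times> 'm \<times> 'm) set"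
  where
  "entwined_modules A m \<eta> X \<psi> \<delta> \<epsilon> = {(M, \<mu>, \<rho>).
     (M, \<mu>) \<in> right_modules C A m \<eta> \<and> \<rho> \<in> hom C M (M \<odot> X) \<and>
     \<rho> \<cdot> \<mu> = (\<mu> \<otimes> \<iota> X) \<cdot> (\<iota> M \<otimes> \<psi>) \<cdot> (\<rho> \<otimes> \<iota> A) \<and>
     (\<rho> \<otimes> \<iota> X) \<cdot> \<rho> = (\<mu> \<otimes> \<iota> X \<otimes> \<iota> X) \<cdot> (\<iota> M \<otimes> \<delta>) \<cdot> \<rho> \<and>
     \<mu> \<cdot> (\<iota> M \<otimes> \<epsilon>) \<cdot> \<rho> = \<iota> M}"

definition entwined_cat :: "'o \<Rightarrow> 'm \<Rightarrow> 'm \<Rightarrow> 'o \<Rightarrow> 'm \<Rightarrow> 'm \<Rightarrow> 'm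
    \<Rightarrow> ('o \<times> 'm \<times> 'm, ('o \<times> 'm \<times> 'm) \<times> 'm \<times> ('o \<times> 'm \<times> 'm)) cat" where
  "entwined_cat A m \<eta> X \<psi> \<delta> \<epsilon> = cat_of_homs (entwined_modules A m \<eta> X \<psi> \<delta> \<epsilon>)
     (\<lambda>(M, \<mu>, \<rho>) (N, \<nu>, \<sigma>).
        {f \<in> right_linear C A (M, \<mu>) (N, \<nu>). (f \<otimes> \<iota> X) \<cdot> \<rho> = \<sigma> \<cdot> f})
     (\<lambda>(M, \<mu>, \<rho>). \<iota> M) (\<lambda>_ g f. g \<cdot> f)"

definition cofree_func :: "'o \<Rightarrow> 'm \<Rightarrow> 'm
    \<Rightarrow> ('o \<times> 'm, ('o \<times> 'm) \<times> 'm \<times> ('o \<times> 'm),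
        'o \<times> 'm \<times> 'm, ('o \<times> 'm \<times> 'm) \<times> 'm \<times> ('o \<times> 'm \<times> 'm)) func" where
  "cofree_func X \<psi> \<delta> =
     (let GO = (\<lambda>(N, \<mu>). (N \<odot> X, (\<mu> \<otimes> \<iota> X) \<cdot> (\<iota> N \<otimes> \<psi>),
                            (\<mu> \<otimes> \<iota> X \<otimes> \<iota> X) \<cdot> (\<iota> N \<otimes> \<delta>)))
      in \<lparr>FO = GO, FM = (\<lambda>(M, f, N). (GO M, f \<otimes> \<iota> X, GO N))\<rparr>)"

end

definition forget_func ::
    "('o \<times> 'm \<times> 'm, ('o \<times> 'm \<times> 'm) \<times> 'm \<times> ('o \<times> 'm \<times> 'm),
      'o \<times> 'm, ('o \<times> 'm) \<times> 'm \<times> ('o \<times> 'm)) func" where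
  "forget_func =
     (let U = (\<lambda>(M, \<mu>, \<rho>). (M, \<mu>))
      in \<lparr>FO = U, FM = (\<lambda>(M, f, N). (U M, f, U N))\<rparr>)"


section \<open>The explicit form of a cowreath, and the adjunction\<close>

lemma hom_iff: "f \<in> hom C X Y \<longleftrightarrow> f \<in> Arr C \<and> Dom C f = X \<and> Cod C f = Y"
  by (simp add: hom_def)

lemma cat_of_homs_hom [simp]:
  "hom (cat_of_homs Ob H i c) X Y = (if X \<in> Ob \<and> Y \<in> Ob then (\<lambda>f. (X, f, Y)) ` H X Y else {})"
  by (auto simp: hom_def cat_of_homs_def)

lemma cat_of_homs_sel [simp]:
  "Obj (cat_of_homs Ob H i c) = Ob"
  "Ide (cat_of_homs Ob H i c) X = (X, i X, X)"
  "Comp (cat_of_homs Ob H i c) (Y', g, Z) (X, f, Y) = (X, c Z g f, Z)"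
  by (simp_all add: cat_of_homs_def)

lemma category_cat_of_homs:
  assumes "\<And>X. X \<in> Ob \<Longrightarrow> i X \<in> H X X"
    and "\<And>X Y Z f g. \<lbrakk>X \<in> Ob; Y \<in> Ob; Z \<in> Ob; f \<in> H X Y; g \<in> H Y Z\<rbrakk> \<Longrightarrow> c Z g f \<in> H X Z"
    and "\<And>X Y f. \<lbrakk>X \<in> Ob; Y \<in> Ob; f \<in> H X Y\<rbrakk> \<Longrightarrow> c Y (i Y) f = f"
    and "\<And>X Y f. \<lbrakk>X \<in> Ob; Y \<in> Ob; f \<in> H X Y\<rbrakk> \<Longrightarrow> c Y f (i X) = f"
    and "\<And>W X Y Z f g h. \<lbrakk>W \<in> Ob; X \<in> Ob; Y \<in> Ob; Z \<in> Ob; f \<in> H W X; g \<in> H X Y; h \<in> H Y Z\<rbrakk>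
      \<Longrightarrow> c Z (c Z h g) f = c Z h (c Y g f)"
  shows "category (cat_of_homs Ob H i c)"
  by unfold_locales (auto simp: assms split: if_splits, auto simp: cat_of_homs_def)

lemma transfer_cat_sel:
  fixes C (structure) and A m \<eta>
  defines "T \<equiv> transfer_cat C A m \<eta>"
  shows "Obj T = transfer_objs C A m \<eta>"
    "hom T S S' = (if S \<in> Obj T \<and> S' \<in> Obj T then (\<lambda>f. (S, f, S')) ` transfer_homs C A m S S' else {})"
    "Ide T (X, \<psi>) = ((X, \<psi>), \<eta> \<otimes> \<iota> X, (X, \<psi>))"
    "Comp T (U, g, (X, \<psi>)) (S, f, S') = (S, (m \<otimes> \<iota> X) \<cdot> (\<iota> A \<otimes> g) \<cdot> f, (X, \<psi>))"
    "Unit T = (\<one>, \<iota> A)"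
    "TensO T (X, \<psi>) (Y, \<phi>) = (X \<odot> Y, (\<psi> \<otimes> \<iota> Y) \<cdot> (\<iota> X \<otimes> \<phi>))"
    "TensM T (S, f, (X, \<psi>)) (S', g, (Y, \<phi>)) = (TensO T S S', 
      (m \<otimes> \<iota> X \<otimes> \<iota> Y) \<cdot> (\<iota> A \<otimes> \<psi> \<otimes> \<iota> Y) \<cdot> (f \<otimes> g), TensO T (X, \<psi>) (Y, \<phi>))"
  by (auto simp: T_def transfer_cat_def cat.defs moncat.defs cat_of_homs_def hom_def Let_def split: prod.splits)

lemma forget_func_sel [simp]:
  "FO forget_func (M, \<mu>, \<rho>) = (M, \<mu>)"
  "FM forget_func (S, f, S') = (FO forget_func S, f, FO forget_func S')"
  by (simp_all add: forget_func_def Let_def)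

lemma cofree_func_sel [simp]:
  fixes C (structure)
  shows "FO (cofree_func C X \<psi> \<delta>) (N, \<mu>) = (N \<odot> X, (\<mu> \<otimes> \<iota> X) \<cdot> (\<iota> N \<otimes> \<psi>), (\<mu> \<otimes> \<iota> X \<otimes> \<iota> X) \<cdot> (\<iota> N \<otimes> \<delta>))"
    "FM (cofree_func C X \<psi> \<delta>) (S, f, S') =
      (FO (cofree_func C X \<psi> \<delta>) S, f \<otimes> \<iota> X, FO (cofree_func C X \<psi> \<delta>) S')"
  by (simp_all add: cofree_func_def Let_def)

lemma func_sel [simp]: "FO id_func X = X" "FM id_func f = f"
  "FO (G \<circ>\<^sub>F F) X = FO G (FO F X)" "FM (G \<circ>\<^sub>F F) f = FM G (FM F f)"
  by (simp_all add: id_func_def comp_func_def)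

context category begin
lemma hom_ObjD: "f \<in> hom C X Y \<Longrightarrow> X \<in> Obj C" "f \<in> hom C X Y \<Longrightarrow> Y \<in> Obj C"
  using Dom_Obj Cod_Obj by (auto simp: hom_iff)
lemma Ide_typed [simp]: "X \<in> Obj C \<Longrightarrow> \<iota> X \<in> Arr C" "X \<in> Obj C \<Longrightarrow> Dom C (\<iota> X) = X" "X \<in> Obj C \<Longrightarrow> Cod C (\<iota> X) = X"
  using Ide_hom by (auto simp: hom_iff)
lemma Comp_typed [simp]: 
  assumes "f \<in> Arr C" "g \<in> Arr C" "Dom C g = Cod C f" 
  shows "g \<cdot> f \<in> Arr C" "Dom C (g \<cdot> f) = Dom C f" "Cod C (g \<cdot> f) = Cod C g"
  using Comp_hom[of f "Dom C f" "Cod C f" g "Cod C g"] assms by (auto simp: hom_iff)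
lemma Comp_Ide [simp]: "f \<in> Arr C \<Longrightarrow> Cod C f = Y \<Longrightarrow> \<iota> Y \<cdot> f = f" "f \<in> Arr C \<Longrightarrow> Dom C f = X \<Longrightarrow> f \<cdot> \<iota> X = f"
  using Ide_left Ide_right by (auto simp: hom_iff)
lemma Comp_assoc_typed [simp]: "f \<in> Arr C \<Longrightarrow> g \<in> Arr C \<Longrightarrow> h \<in> Arr C \<Longrightarrow> Dom C h = Cod C g \<Longrightarrow> Dom C g = Cod C f
  \<Longrightarrow> (h \<cdot> g) \<cdot> f = h \<cdot> (g \<cdot> f)"
  using Comp_assoc by (auto simp: hom_iff)
declare Dom_Obj [simp] Cod_Obj [simp]
end

context strict_monoidal_category begin
declare Unit_Obj [simp] TensO_Obj [simp] TensM_Ide [simp] TensO_assoc [simp] TensO_Unit_left [simp] TensO_Unit_right [simp]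
  TensM_assoc[simp] TensM_Unit_left[simp] TensM_Unit_right[simp]
lemma TensM_typed [simp]: 
  assumes "f \<in> Arr C" "g \<in> Arr C" 
  shows "f \<otimes> g \<in> Arr C" "Dom C (f \<otimes> g) = Dom C f \<odot> Dom C g" "Cod C (f \<otimes> g) = Cod C f \<odot> Cod C g"
  using TensM_hom[of f "Dom C f" "Cod C f" g "Dom C g" "Cod C g"] assms by (auto simp: hom_iff)
lemma TensM_interchange: "f \<in> Arr C \<Longrightarrow> f' \<in> Arr C \<Longrightarrow> g \<in> Arr C \<Longrightarrow> g' \<in> Arr C \<Longrightarrow> Dom C f' = Cod C f \<Longrightarrow> Dom C g' = Cod C g 
  \<Longrightarrow> (f' \<cdot> f) \<otimes> (g' \<cdot> g) = (f' \<otimes> g') \<cdot> (f \<otimes> g)"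
  using TensM_Comp by (auto simp: hom_iff)
lemma whisker_right_Comp [simp]: "f \<in> Arr C \<Longrightarrow> f' \<in> Arr C \<Longrightarrow> Z \<in> Obj C \<Longrightarrow> Dom C f' = Cod C f \<Longrightarrow> (f' \<cdot> f) \<otimes> \<iota> Z = (f' \<otimes> \<iota> Z) \<cdot> (f \<otimes> \<iota> Z)"
  using TensM_interchange[of f f' "\<iota> Z" "\<iota> Z"] by auto
lemma whisker_left_Comp [simp]: "f \<in> Arr C \<Longrightarrow> f' \<in> Arr C \<Longrightarrow> Z \<in> Obj C \<Longrightarrow> Dom C f' = Cod C f \<Longrightarrow> \<iota> Z \<otimes> (f' \<cdot> f) = (\<iota> Z \<otimes> f') \<cdot> (\<iota> Z \<otimes> f)"
  using TensM_interchange[of "\<iota> Z" "\<iota> Z" f f'] by auto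
lemma whisker_left_twice [simp]: "f \<in> Arr C \<Longrightarrow> X \<in> Obj C \<Longrightarrow> Y \<in> Obj C \<Longrightarrow> \<iota> X \<otimes> \<iota> Y \<otimes> f = \<iota> (X \<odot> Y) \<otimes> f"
  by (simp flip: TensM_assoc TensM_Ide)
lemma slide: "f \<in> Arr C \<Longrightarrow> g \<in> Arr C \<Longrightarrow> Dom C f = X \<Longrightarrow> Cod C f = X' \<Longrightarrow> Dom C g = Y \<Longrightarrow> Cod C g = Y' \<Longrightarrow>
    (f \<otimes> \<iota> Y') \<cdot> (\<iota> X \<otimes> g) = f \<otimes> g"
  "f \<in> Arr C \<Longrightarrow> g \<in> Arr C \<Longrightarrow> Dom C f = X \<Longrightarrow> Cod C f = X' \<Longrightarrow> Dom C g = Y \<Longrightarrow> Cod C g = Y' \<Longrightarrow>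
    (\<iota> X' \<otimes> g) \<cdot> (f \<otimes> \<iota> Y) = f \<otimes> g"
  using TensM_interchange[of "\<iota> X" f g "\<iota> Y'"] TensM_interchange[of f "\<iota> X'" "\<iota> Y" g] by auto


lemma module_comp:
  assumes "(N, \<mu>) \<in> right_modules C A m \<eta>" "m \<in> hom C (A \<odot> A) A" "A \<in> Obj C"
    and "h \<in> hom C W (A \<odot> Z)" "k \<in> hom C Z (A \<odot> Z')" "Z \<in> Obj C" "Z' \<in> Obj C"
  shows "(\<mu> \<otimes> \<iota> Z') \<cdot> (\<iota> N \<otimes> k) \<cdot> (\<mu> \<otimes> \<iota> Z) \<cdot> (\<iota> N \<otimes> h)
    = (\<mu> \<otimes> \<iota> Z') \<cdot> (\<iota> N \<otimes> ((m \<otimes> \<iota> Z') \<cdot> (\<iota> A \<otimes> k) \<cdot> h))"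
proof -
  have N: "N \<in> Obj C" "\<mu> \<in> Arr C" "Dom C \<mu> = N \<odot> A" "Cod C \<mu> = N"
    and ass: "\<mu> \<cdot> (\<mu> \<otimes> \<iota> A) = \<mu> \<cdot> (\<iota> N \<otimes> m)"
    using assms by (auto simp: right_modules_def hom_iff)
  note t [simp] = N assms(2-)[unfolded hom_iff]
  have "(\<iota> N \<otimes> k) \<cdot> (\<mu> \<otimes> \<iota> Z) = (\<mu> \<otimes> \<iota> (A \<odot> Z')) \<cdot> (\<iota> (N \<odot> A) \<otimes> k)"
    using slide(1)[of \<mu> k "N \<odot> A" N Z "A \<odot> Z'"] slide(2)[of \<mu> k "N \<odot> A" N Z "A \<odot> Z'"] by simp
  then have "(\<mu> \<otimes> \<iota> Z') \<cdot> (\<iota> N \<otimes> k) \<cdot> (\<mu> \<otimes> \<iota> Z) \<cdot> (\<iota> N \<otimes> h)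
     = (\<mu> \<otimes> \<iota> Z') \<cdot> (\<mu> \<otimes> \<iota> (A \<odot> Z')) \<cdot> (\<iota> (N \<odot> A) \<otimes> k) \<cdot> (\<iota> N \<otimes> h)"
    by (simp flip: Comp_assoc_typed)
  also have "\<dots> = ((\<mu> \<cdot> (\<mu> \<otimes> \<iota> A)) \<otimes> \<iota> Z') \<cdot> (\<iota> (N \<odot> A) \<otimes> k) \<cdot> (\<iota> N \<otimes> h)"
    by simp
  also have "\<dots> = (\<mu> \<otimes> \<iota> Z') \<cdot> (\<iota> N \<otimes> ((m \<otimes> \<iota> Z') \<cdot> (\<iota> A \<otimes> k) \<cdot> h))"
    unfolding ass by simp
  finally show ?thesis .
qed

lemma module_comp':
  assumes "(N, \<mu>) \<in> right_modules C A m \<eta>" "m \<in> hom C (A \<odot> A) A" "A \<in> Obj C"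
    and "h \<in> hom C W (A \<odot> Z)" "k \<in> hom C Z (A \<odot> Z')" "Z \<in> Obj C" "Z' \<in> Obj C"
  shows "((\<mu> \<otimes> \<iota> Z') \<cdot> (\<iota> N \<otimes> k)) \<cdot> ((\<mu> \<otimes> \<iota> Z) \<cdot> (\<iota> N \<otimes> h))
    = (\<mu> \<otimes> \<iota> Z') \<cdot> (\<iota> N \<otimes> ((m \<otimes> \<iota> Z') \<cdot> (\<iota> A \<otimes> k) \<cdot> h))"
  using assms module_comp[OF assms] by (auto simp: hom_iff right_modules_def)

lemma category_module_cat:
  assumes "algebra C A m \<eta>" shows "category (module_cat C A m \<eta>)"
  unfolding module_cat_def
proof (rule category_cat_of_homs, goal_cases)
  case (2 X Y Z f g)
  obtain M \<mu> N \<nu> K \<kappa> where e[simp]: "X = (M, \<mu>)" "Y = (N, \<nu>)" "Z = (K, \<kappa>)" by (cases X, cases Y, cases Z)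
  note [simp] = 2[simplified, unfolded right_modules_def right_linear_def hom_iff, simplified]
  have [simp]: "A \<in> Obj C" using assms by (simp add: algebra_def)
  have "(g \<cdot> f) \<cdot> \<mu> = (g \<cdot> \<nu>) \<cdot> (f \<otimes> \<iota> A)"
    using 2 by (subst Comp_assoc_typed) (auto simp: right_modules_def right_linear_def hom_iff)
  also have "\<dots> = \<kappa> \<cdot> ((g \<cdot> f) \<otimes> \<iota> A)"
    by simp
  finally have "g \<cdot> f \<cdot> \<mu> = \<kappa> \<cdot> ((g \<cdot> f) \<otimes> \<iota> A)"
    by simp
  then show ?case by (simp add: right_linear_def hom_iff)
qed (use assms in \<open>auto simp: right_modules_def right_linear_def algebra_def hom_iff\<close>)
 
lemma algebra_facts:
  assumes "algebra C A m \<eta>"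
  shows "A \<in> Obj C" "m \<in> hom C (A \<odot> A) A" "\<eta> \<in> hom C \<one> A"
  using assms by (auto simp: algebra_def)

lemma transfer_tensor_unit_right:
  assumes alg: "algebra C A m \<eta>" and "(Z, \<phi>) \<in> transfer_objs C A m \<eta>"
    and "f \<in> hom C W (A \<odot> Z)" and "X \<in> Obj C"
  shows "(m \<otimes> \<iota> (Z \<odot> X)) \<cdot> (\<iota> A \<otimes> \<phi> \<otimes> \<iota> X) \<cdot> (f \<otimes> \<eta> \<otimes> \<iota> X) = f \<otimes> \<iota> X"
proof -
  note [simp] = algebra_facts[OF alg, unfolded hom_iff] assms(3,4)[unfolded hom_iff]
  have [simp]: "Z \<in> Obj C" "\<phi> \<in> Arr C" "Dom C \<phi> = Z \<odot> A" "Cod C \<phi> = A \<odot> Z" and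
    e: "\<phi> \<cdot> (\<iota> Z \<otimes> \<eta>) = \<eta> \<otimes> \<iota> Z" using assms(2) by (auto simp: transfer_objs_def hom_iff)
  have [simp]: "W \<in> Obj C" using Dom_Obj[of f] by simp
  have u: "m \<cdot> (\<iota> A \<otimes> \<eta>) = \<iota> A" using alg by (simp add: algebra_def)
  have 1: "f \<otimes> \<eta> \<otimes> \<iota> X = (\<iota> (A \<odot> Z) \<otimes> \<eta> \<otimes> \<iota> X) \<cdot> (f \<otimes> \<iota> X)"
    using slide(2)[of f "\<eta> \<otimes> \<iota> X"] by simp
  have "(\<iota> A \<otimes> \<phi> \<otimes> \<iota> X) \<cdot> (\<iota> (A \<odot> Z) \<otimes> \<eta> \<otimes> \<iota> X) = \<iota> A \<otimes> (\<phi> \<cdot> (\<iota> Z \<otimes> \<eta>)) \<otimes> \<iota> X"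
    by simp
  also have "(m \<otimes> \<iota> (Z \<odot> X)) \<cdot> \<dots> = (m \<cdot> (\<iota> A \<otimes> \<eta>)) \<otimes> \<iota> (Z \<odot> X)"
    unfolding e by simp
  also have "\<dots> \<cdot> (f \<otimes> \<iota> X) = f \<otimes> \<iota> X" unfolding u by simp
  finally show ?thesis unfolding 1 by simp
qed

lemma transfer_tensor_unit_left:
  assumes alg: "algebra C A m \<eta>" and "(X, \<psi>) \<in> transfer_objs C A m \<eta>"
    and "g \<in> hom C V (A \<odot> Y)" and "Y \<in> Obj C"
  shows "(m \<otimes> \<iota> (X \<odot> Y)) \<cdot> (\<iota> A \<otimes> \<psi> \<otimes> \<iota> Y) \<cdot> (\<eta> \<otimes> \<iota> X \<otimes> g) = (\<psi> \<otimes> \<iota> Y) \<cdot> (\<iota> X \<otimes> g)"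
proof -
  note [simp] = algebra_facts[OF alg, unfolded hom_iff] assms(3,4)[unfolded hom_iff]
  have [simp]: "X \<in> Obj C" "\<psi> \<in> Arr C" "Dom C \<psi> = X \<odot> A" "Cod C \<psi> = A \<odot> X"
    using assms(2) by (auto simp: transfer_objs_def hom_iff)
  have [simp]: "V \<in> Obj C" using Dom_Obj[of g] by simp
  have u: "m \<cdot> (\<eta> \<otimes> \<iota> A) = \<iota> A" using alg by (simp add: algebra_def)
  have 1: "\<eta> \<otimes> \<iota> X \<otimes> g = (\<eta> \<otimes> \<iota> (X \<odot> A \<odot> Y)) \<cdot> (\<iota> X \<otimes> g)"
    using slide(1)[of \<eta> "\<iota> X \<otimes> g" \<one> A] by simp
  have "(\<iota> A \<otimes> \<psi> \<otimes> \<iota> Y) \<cdot> (\<eta> \<otimes> \<iota> (X \<odot> A \<odot> Y)) = (\<eta> \<otimes> \<iota> (A \<odot> X \<odot> Y)) \<cdot> (\<psi> \<otimes> \<iota> Y)"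
    using slide(1)[of \<eta> "\<psi> \<otimes> \<iota> Y" \<one> A] slide(2)[of \<eta> "\<psi> \<otimes> \<iota> Y" \<one> A] by simp
  then have 2: "(\<iota> A \<otimes> \<psi> \<otimes> \<iota> Y) \<cdot> (\<eta> \<otimes> \<iota> (X \<odot> A \<odot> Y)) \<cdot> (\<iota> X \<otimes> g) = (\<eta> \<otimes> \<iota> (A \<odot> X \<odot> Y)) \<cdot> (\<psi> \<otimes> \<iota> Y) \<cdot> (\<iota> X \<otimes> g)"
    by (simp flip: Comp_assoc_typed)
  have "(m \<otimes> \<iota> (X \<odot> Y)) \<cdot> (\<eta> \<otimes> \<iota> (A \<odot> X \<odot> Y)) = (m \<cdot> (\<eta> \<otimes> \<iota> A)) \<otimes> \<iota> (X \<odot> Y)"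
    by simp
  also have "\<dots> = \<iota> (A \<odot> X \<odot> Y)" unfolding u by simp
  finally have 3: "(m \<otimes> \<iota> (X \<odot> Y)) \<cdot> (\<eta> \<otimes> \<iota> (A \<odot> X \<odot> Y)) = \<iota> (A \<odot> X \<odot> Y)" .
  have "(m \<otimes> \<iota> (X \<odot> Y)) \<cdot> (\<eta> \<otimes> \<iota> (A \<odot> X \<odot> Y)) \<cdot> (\<psi> \<otimes> \<iota> Y) \<cdot> (\<iota> X \<otimes> g) = (\<psi> \<otimes> \<iota> Y) \<cdot> (\<iota> X \<otimes> g)"
    by (subst Comp_assoc_typed[symmetric]) (simp_all add: 3)
  then show ?thesis unfolding 1 2 .
qed

lemma transfer_objs_tens:
  assumes alg: "algebra C A m \<eta>" and "(X, \<psi>) \<in> transfer_objs C A m \<eta>" "(Y, \<phi>) \<in> transfer_objs C A m \<eta>"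
  shows "(X \<odot> Y, (\<psi> \<otimes> \<iota> Y) \<cdot> (\<iota> X \<otimes> \<phi>)) \<in> transfer_objs C A m \<eta>"
proof -
  note [simp] = algebra_facts[OF alg, unfolded hom_iff]
  have [simp]: "X \<in> Obj C" "\<psi> \<in> Arr C" "Dom C \<psi> = X \<odot> A" "Cod C \<psi> = A \<odot> X"
    and p: "\<psi> \<cdot> (\<iota> X \<otimes> m) = (m \<otimes> \<iota> X) \<cdot> (\<iota> A \<otimes> \<psi>) \<cdot> (\<psi> \<otimes> \<iota> A)" "\<psi> \<cdot> (\<iota> X \<otimes> \<eta>) = \<eta> \<otimes> \<iota> X"
    using assms(2) by (auto simp: transfer_objs_def hom_iff)
  have [simp]: "Y \<in> Obj C" "\<phi> \<in> Arr C" "Dom C \<phi> = Y \<odot> A" "Cod C \<phi> = A \<odot> Y"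
    and q: "\<phi> \<cdot> (\<iota> Y \<otimes> m) = (m \<otimes> \<iota> Y) \<cdot> (\<iota> A \<otimes> \<phi>) \<cdot> (\<phi> \<otimes> \<iota> A)" "\<phi> \<cdot> (\<iota> Y \<otimes> \<eta>) = \<eta> \<otimes> \<iota> Y"
    using assms(3) by (auto simp: transfer_objs_def hom_iff)
  have s: "(\<psi> \<otimes> \<iota> (A \<odot> Y)) \<cdot> (\<iota> (X \<odot> A) \<otimes> \<phi>) = (\<iota> (A \<odot> X) \<otimes> \<phi>) \<cdot> (\<psi> \<otimes> \<iota> (Y \<odot> A))"
    using slide(1)[of \<psi> \<phi> "X \<odot> A" "A \<odot> X"] slide(2)[of \<psi> \<phi> "X \<odot> A" "A \<odot> X"] by simp
  have "((\<psi> \<otimes> \<iota> Y) \<cdot> (\<iota> X \<otimes> \<phi>)) \<cdot> (\<iota> (X \<odot> Y) \<otimes> m) = (\<psi> \<otimes> \<iota> Y) \<cdot> (\<iota> X \<otimes> (\<phi> \<cdot> (\<iota> Y \<otimes> m)))"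
    by simp
  also have "\<dots> = ((\<psi> \<cdot> (\<iota> X \<otimes> m)) \<otimes> \<iota> Y) \<cdot> (\<iota> (X \<odot> A) \<otimes> \<phi>) \<cdot> (\<iota> X \<otimes> \<phi> \<otimes> \<iota> A)"
    unfolding q by simp
  also have "\<dots> = (m \<otimes> \<iota> (X \<odot> Y)) \<cdot> (\<iota> A \<otimes> \<psi> \<otimes> \<iota> Y) \<cdot>
      ((\<psi> \<otimes> \<iota> (A \<odot> Y)) \<cdot> (\<iota> (X \<odot> A) \<otimes> \<phi>)) \<cdot> (\<iota> X \<otimes> \<phi> \<otimes> \<iota> A)"
    unfolding p by simp
  also have "\<dots> = (m \<otimes> \<iota> (X \<odot> Y)) \<cdot> (\<iota> A \<otimes> ((\<psi> \<otimes> \<iota> Y) \<cdot> (\<iota> X \<otimes> \<phi>))) \<cdot> (((\<psi> \<otimes> \<iota> Y) \<cdot> (\<iota> X \<otimes> \<phi>)) \<otimes> \<iota> A)"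
    unfolding s by simp
  finally have 1: "((\<psi> \<otimes> \<iota> Y) \<cdot> (\<iota> X \<otimes> \<phi>)) \<cdot> (\<iota> (X \<odot> Y) \<otimes> m) = \<dots>" .
  have "((\<psi> \<otimes> \<iota> Y) \<cdot> (\<iota> X \<otimes> \<phi>)) \<cdot> (\<iota> (X \<odot> Y) \<otimes> \<eta>) = (\<psi> \<otimes> \<iota> Y) \<cdot> (\<iota> X \<otimes> (\<phi> \<cdot> (\<iota> Y \<otimes> \<eta>)))"
    by simp
  also have "\<dots> = (\<psi> \<cdot> (\<iota> X \<otimes> \<eta>)) \<otimes> \<iota> Y" unfolding q by simp
  also have "\<dots> = \<eta> \<otimes> \<iota> (X \<odot> Y)" unfolding p by simp
  finally have "((\<psi> \<otimes> \<iota> Y) \<cdot> (\<iota> X \<otimes> \<phi>)) \<cdot> (\<iota> (X \<odot> Y) \<otimes> \<eta>) = \<dots>" .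
  with 1 show ?thesis unfolding transfer_objs_def by (simp del: Comp_assoc_typed add: hom_iff)
qed

lemma cowreath_iff:
  "cowreath C A m \<eta> X \<psi> \<delta> \<epsilon> \<longleftrightarrow>
     algebra C A m \<eta> \<and> (X, \<psi>) \<in> transfer_objs C A m \<eta> \<and>
     \<delta> \<in> hom C X (A \<odot> X \<odot> X) \<and> \<epsilon> \<in> hom C X A \<and>
     (m \<otimes> \<iota> X \<otimes> \<iota> X) \<cdot> (\<iota> A \<otimes> \<psi> \<otimes> \<iota> X) \<cdot> (\<iota> A \<otimes> \<iota> X \<otimes> \<psi>) \<cdot> (\<delta> \<otimes> \<iota> A)
       = (m \<otimes> \<iota> X \<otimes> \<iota> X) \<cdot> (\<iota> A \<otimes> \<delta>) \<cdot> \<psi> \<and>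
     (m \<otimes> \<iota> X \<otimes> \<iota> X \<otimes> \<iota> X) \<cdot> (\<iota> A \<otimes> \<delta> \<otimes> \<iota> X) \<cdot> \<delta>
       = (m \<otimes> \<iota> X \<otimes> \<iota> X \<otimes> \<iota> X) \<cdot> (\<iota> A \<otimes> \<psi> \<otimes> \<iota> X \<otimes> \<iota> X) \<cdot> (\<iota> A \<otimes> \<iota> X \<otimes> \<delta>) \<cdot> \<delta> \<and>
     m \<cdot> (\<iota> A \<otimes> \<epsilon>) \<cdot> \<psi> = m \<cdot> (\<epsilon> \<otimes> \<iota> A) \<and>
     (m \<otimes> \<iota> X) \<cdot> (\<iota> A \<otimes> \<epsilon> \<otimes> \<iota> X) \<cdot> \<delta> = \<eta> \<otimes> \<iota> X \<and>
     (m \<otimes> \<iota> X) \<cdot> (\<iota> A \<otimes> \<psi>) \<cdot> (\<iota> A \<otimes> \<iota> X \<otimes> \<epsilon>) \<cdot> \<delta> = \<eta> \<otimes> \<iota> X"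
  (is "?L = ?R")
proof (cases "algebra C A m \<eta> \<and> X \<in> Obj C \<and> (X, \<psi>) \<in> transfer_objs C A m \<eta> \<and> \<delta> \<in> hom C X (A \<odot> X \<odot> X) \<and> \<epsilon> \<in> hom C X A")
  case False
  then show ?thesis
  proof -
    have "\<not> ?R" using False by (auto simp: transfer_objs_def)
    moreover have "\<not> ?L"
    proof
      assume ?L
      then have "algebra C A m \<eta>" "X \<in> Obj C" "(X, \<psi>) \<in> transfer_objs C A m \<eta>" "\<delta> \<in> hom C X (A \<odot> X \<odot> X)" "\<epsilon> \<in> hom C X (A \<odot> \<one>)"
        unfolding cowreath_def Let_def coalgebra_def transfer_cat_sel
        by (auto simp: transfer_homs_def transfer_objs_def split: if_splits)
      with False show False by (simp add: algebra_def)
    qed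
    ultimately show ?thesis by blast
  qed
next
  case True
  then have alg: "algebra C A m \<eta>" and tr: "(X, \<psi>) \<in> transfer_objs C A m \<eta>" and de: "\<delta> \<in> hom C X (A \<odot> X \<odot> X)" "\<epsilon> \<in> hom C X A" by auto
  note [simp] = de[unfolded hom_iff] algebra_facts[OF alg, unfolded hom_iff] 
  have [simp]: "X \<in> Obj C" "\<psi> \<in> Arr C" "Dom C \<psi> = X \<odot> A" "Cod C \<psi> = A \<odot> X"
    and p1: "\<psi> \<cdot> (\<iota> X \<otimes> m) = (m \<otimes> \<iota> X) \<cdot> (\<iota> A \<otimes> \<psi>) \<cdot> (\<psi> \<otimes> \<iota> A)"
    and p2: "\<psi> \<cdot> (\<iota> X \<otimes> \<eta>) = \<eta> \<otimes> \<iota> X"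
    using tr by (auto simp: transfer_objs_def hom_iff)
  have u: "(\<one>, \<iota> A) \<in> transfer_objs C A m \<eta>" by (simp add: transfer_objs_def hom_iff)
  have xx: "(X \<odot> X, (\<psi> \<otimes> \<iota> X) \<cdot> (\<iota> X \<otimes> \<psi>)) \<in> transfer_objs C A m \<eta>" 
    using transfer_objs_tens[OF alg tr tr] .
  note 1 = transfer_tensor_unit_right[OF alg xx de(1), of X]
  have "\<epsilon> \<in> hom C X (A \<odot> \<one>)" by (simp add: hom_iff)
  note 2 = transfer_tensor_unit_right[OF alg u this, of X]
  note 3 = transfer_tensor_unit_left[OF alg tr de(1)]
  note 4 = transfer_tensor_unit_left[OF alg tr \<open>\<epsilon> \<in> hom C X (A \<odot> \<one>)\<close>]
  note 5 = 1[THEN arg_cong, of "\<lambda>x. (\<iota> A \<otimes> x) \<cdot> \<delta>", simplified] 2[THEN arg_cong, of "\<lambda>x. (\<iota> A \<otimes> x) \<cdot> \<delta>", simplified]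
    3[THEN arg_cong, of "\<lambda>x. (\<iota> A \<otimes> x) \<cdot> \<delta>", simplified] 4[THEN arg_cong, of "\<lambda>x. (\<iota> A \<otimes> x) \<cdot> \<delta>", simplified]
  show ?thesis
    unfolding cowreath_def Let_def coalgebra_def transfer_cat_sel
    apply (simp add: alg tr u xx transfer_homs_def image_iff 5)
    apply (auto simp add: hom_iff)
    done
qed

lemma transfer_hom_unit:
  assumes alg: "algebra C A m \<eta>" and "(X, \<psi>) \<in> transfer_objs C A m \<eta>"
  defines "T \<equiv> transfer_cat C A m \<eta>"
  shows "hom T (Unit T) (X, \<psi>) = (\<lambda>t. (Unit T, t, (X, \<psi>))) `
    {t \<in> hom C \<one> (A \<odot> X). (m \<otimes> \<iota> X) \<cdot> (\<iota> A \<otimes> t) = (m \<otimes> \<iota> X) \<cdot> (\<iota> A \<otimes> \<psi>) \<cdot> (t \<otimes> \<iota> A)}"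
proof -
  note [simp] = algebra_facts[OF alg, unfolded hom_iff]
  have "(\<one>, \<iota> A) \<in> transfer_objs C A m \<eta>" by (simp add: transfer_objs_def hom_iff)
  moreover have "X \<in> Obj C" using assms(2) by (simp add: transfer_objs_def)
  ultimately show ?thesis
    using assms(2) by (auto simp: T_def transfer_cat_sel transfer_homs_def hom_iff[of _ C] image_iff)
qed

lemma right_modules_facts:
  assumes "(N, \<mu>) \<in> right_modules C A m \<eta>"
  shows "N \<in> Obj C" "\<mu> \<in> hom C (N \<odot> A) N" "\<mu> \<cdot> (\<mu> \<otimes> \<iota> A) = \<mu> \<cdot> (\<iota> N \<otimes> m)" "\<mu> \<cdot> (\<iota> N \<otimes> \<eta>) = \<iota> N"
  using assms by (auto simp: right_modules_def)

lemma category_entwined_cat: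
  assumes "algebra C A m \<eta>" "X \<in> Obj C" shows "category (entwined_cat C A m \<eta> X \<psi> \<delta> \<epsilon>)"
  unfolding entwined_cat_def
proof (rule category_cat_of_homs, goal_cases)
  case (2 X' Y Z f g)
  obtain M \<mu> \<rho> N \<nu> \<sigma> K \<kappa> \<tau> where e[simp]: "X' = (M, \<mu>, \<rho>)" "Y = (N, \<nu>, \<sigma>)" "Z = (K, \<kappa>, \<tau>)" by (cases X', cases Y, cases Z)
  note [simp] = 2[simplified, unfolded right_modules_def right_linear_def hom_iff entwined_modules_def, simplified] assms(2)
  have [simp]: "A \<in> Obj C" using assms by (simp add: algebra_def)
  have "(g \<cdot> f) \<cdot> \<mu> = (g \<cdot> \<nu>) \<cdot> (f \<otimes> \<iota> A)"
    using 2 by (subst Comp_assoc_typed) (auto simp: right_modules_def right_linear_def hom_iff entwined_modules_def)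
  also have "\<dots> = \<kappa> \<cdot> ((g \<cdot> f) \<otimes> \<iota> A)"
    by simp
  finally have 1: "g \<cdot> f \<cdot> \<mu> = \<kappa> \<cdot> ((g \<cdot> f) \<otimes> \<iota> A)"
    by simp
  have "((g \<otimes> \<iota> X) \<cdot> (f \<otimes> \<iota> X)) \<cdot> \<rho> = ((g \<otimes> \<iota> X) \<cdot> \<sigma>) \<cdot> f"
    using 2 by (subst Comp_assoc_typed) (auto simp: right_modules_def right_linear_def hom_iff entwined_modules_def)
  also have "\<dots> = \<tau> \<cdot> (g \<cdot> f)" by simp
  finally have "((g \<otimes> \<iota> X) \<cdot> (f \<otimes> \<iota> X)) \<cdot> \<rho> = \<tau> \<cdot> (g \<cdot> f)" .
  with 1 show ?case by (simp add: right_linear_def hom_iff)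
qed (use assms in \<open>auto simp: right_modules_def right_linear_def algebra_def hom_iff entwined_modules_def\<close>)

lemma cofree_entwined:
  assumes cw: "cowreath C A m \<eta> X \<psi> \<delta> \<epsilon>" and N: "(N, \<mu>) \<in> right_modules C A m \<eta>"
  shows "(N \<odot> X, (\<mu> \<otimes> \<iota> X) \<cdot> (\<iota> N \<otimes> \<psi>), (\<mu> \<otimes> \<iota> X \<otimes> \<iota> X) \<cdot> (\<iota> N \<otimes> \<delta>))
    \<in> entwined_modules C A m \<eta> X \<psi> \<delta> \<epsilon>"
proof -
  note cw' = cw[unfolded cowreath_iff]
  have alg: "algebra C A m \<eta>" using cw' by blast
  note ty = algebra_facts[OF alg] right_modules_facts(1,2)[OF N] 
  have ty2: "X \<in> Obj C" "\<psi> \<in> hom C (X \<odot> A) (A \<odot> X)" "\<delta> \<in> hom C X (A \<odot> X \<odot> X)" "\<epsilon> \<in> hom C X A"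
    using cw' by (auto simp: transfer_objs_def)
  note [simp] = ty[unfolded hom_iff] ty2[unfolded hom_iff]
  have p: "\<psi> \<cdot> (\<iota> X \<otimes> m) = (m \<otimes> \<iota> X) \<cdot> (\<iota> A \<otimes> \<psi>) \<cdot> (\<psi> \<otimes> \<iota> A)" "\<psi> \<cdot> (\<iota> X \<otimes> \<eta>) = \<eta> \<otimes> \<iota> X"
    using cw' by (auto simp: transfer_objs_def)
  note b = module_comp[OF N ty(2,1)]
  let ?a = "(\<mu> \<otimes> \<iota> X) \<cdot> (\<iota> N \<otimes> \<psi>)" and ?c = "(\<mu> \<otimes> \<iota> (X \<odot> X)) \<cdot> (\<iota> N \<otimes> \<delta>)"
  have 1: "?a \<cdot> (?a \<otimes> \<iota> A) = ?a \<cdot> (\<iota> (N \<odot> X) \<otimes> m)"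
  proof -
    have "?a \<cdot> (?a \<otimes> \<iota> A) = (\<mu> \<otimes> \<iota> X) \<cdot> (\<iota> N \<otimes> \<psi>) \<cdot> (\<mu> \<otimes> \<iota> (X \<odot> A)) \<cdot> (\<iota> N \<otimes> (\<psi> \<otimes> \<iota> A))"
      by simp
    also have "\<dots> = (\<mu> \<otimes> \<iota> X) \<cdot> (\<iota> N \<otimes> (\<psi> \<cdot> (\<iota> X \<otimes> m)))"
      unfolding p by (rule b) (simp_all add: hom_iff)
    finally show ?thesis by simp
  qed
  have 2: "?a \<cdot> (\<iota> (N \<odot> X) \<otimes> \<eta>) = \<iota> (N \<odot> X)"
  proof -
    have "?a \<cdot> (\<iota> (N \<odot> X) \<otimes> \<eta>) = (\<mu> \<otimes> \<iota> X) \<cdot> (\<iota> N \<otimes> (\<psi> \<cdot> (\<iota> X \<otimes> \<eta>)))" by simp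
    also have "\<dots> = (\<mu> \<cdot> (\<iota> N \<otimes> \<eta>)) \<otimes> \<iota> X" unfolding p by simp
    finally show ?thesis unfolding right_modules_facts(4)[OF N] by simp
  qed
  have 3: "?c \<cdot> ?a = (?a \<otimes> \<iota> X) \<cdot> (\<iota> (N \<odot> X) \<otimes> \<psi>) \<cdot> (?c \<otimes> \<iota> A)"
  proof -
    have "?c \<cdot> ?a = (\<mu> \<otimes> \<iota> (X \<odot> X)) \<cdot> (\<iota> N \<otimes> \<delta>) \<cdot> (\<mu> \<otimes> \<iota> X) \<cdot> (\<iota> N \<otimes> \<psi>)" by simp
    also have "\<dots> = (\<mu> \<otimes> \<iota> (X \<odot> X)) \<cdot> (\<iota> N \<otimes> ((m \<otimes> \<iota> (X \<odot> X)) \<cdot> (\<iota> A \<otimes> \<delta>) \<cdot> \<psi>))"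
      by (rule b) (simp_all add: hom_iff)
    also have "(m \<otimes> \<iota> (X \<odot> X)) \<cdot> (\<iota> A \<otimes> \<delta>) \<cdot> \<psi> =
        (m \<otimes> \<iota> (X \<odot> X)) \<cdot> (\<iota> A \<otimes> ((\<psi> \<otimes> \<iota> X) \<cdot> (\<iota> X \<otimes> \<psi>))) \<cdot> (\<delta> \<otimes> \<iota> A)"
      using cw' by simp
    also have "(\<mu> \<otimes> \<iota> (X \<odot> X)) \<cdot> (\<iota> N \<otimes> ((m \<otimes> \<iota> (X \<odot> X)) \<cdot> (\<iota> A \<otimes> ((\<psi> \<otimes> \<iota> X) \<cdot> (\<iota> X \<otimes> \<psi>))) \<cdot> (\<delta> \<otimes> \<iota> A)))
      = (\<mu> \<otimes> \<iota> (X \<odot> X)) \<cdot> (\<iota> N \<otimes> ((\<psi> \<otimes> \<iota> X) \<cdot> (\<iota> X \<otimes> \<psi>))) \<cdot> (\<mu> \<otimes> \<iota> (X \<odot> X \<odot> A)) \<cdot> (\<iota> N \<otimes> (\<delta> \<otimes> \<iota> A))"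
      by (rule b[symmetric]) (simp_all add: hom_iff)
    finally show ?thesis by simp
  qed
  have 4: "(?c \<otimes> \<iota> X) \<cdot> ?c = (?a \<otimes> \<iota> (X \<odot> X)) \<cdot> (\<iota> (N \<odot> X) \<otimes> \<delta>) \<cdot> ?c"
  proof -
    have "(?c \<otimes> \<iota> X) \<cdot> ?c = (\<mu> \<otimes> \<iota> (X \<odot> X \<odot> X)) \<cdot> (\<iota> N \<otimes> (\<delta> \<otimes> \<iota> X)) \<cdot> (\<mu> \<otimes> \<iota> (X \<odot> X)) \<cdot> (\<iota> N \<otimes> \<delta>)" by simp
    also have "\<dots> = (\<mu> \<otimes> \<iota> (X \<odot> X \<odot> X)) \<cdot> (\<iota> N \<otimes> ((m \<otimes> \<iota> (X \<odot> X \<odot> X)) \<cdot> (\<iota> A \<otimes> (\<delta> \<otimes> \<iota> X)) \<cdot> \<delta>))"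
      by (rule b) (simp_all add: hom_iff)
    also have "(m \<otimes> \<iota> (X \<odot> X \<odot> X)) \<cdot> (\<iota> A \<otimes> (\<delta> \<otimes> \<iota> X)) \<cdot> \<delta> =
        (m \<otimes> \<iota> (X \<odot> X \<odot> X)) \<cdot> (\<iota> A \<otimes> ((\<psi> \<otimes> \<iota> (X \<odot> X)) \<cdot> (\<iota> X \<otimes> \<delta>))) \<cdot> \<delta>"
      using cw' by simp
    also have "(\<mu> \<otimes> \<iota> (X \<odot> X \<odot> X)) \<cdot> (\<iota> N \<otimes> ((m \<otimes> \<iota> (X \<odot> X \<odot> X)) \<cdot> (\<iota> A \<otimes> ((\<psi> \<otimes> \<iota> (X \<odot> X)) \<cdot> (\<iota> X \<otimes> \<delta>))) \<cdot> \<delta>))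
      = (\<mu> \<otimes> \<iota> (X \<odot> X \<odot> X)) \<cdot> (\<iota> N \<otimes> ((\<psi> \<otimes> \<iota> (X \<odot> X)) \<cdot> (\<iota> X \<otimes> \<delta>))) \<cdot> (\<mu> \<otimes> \<iota> (X \<odot> X)) \<cdot> (\<iota> N \<otimes> \<delta>)"
      by (rule b[symmetric]) (simp_all add: hom_iff)
    finally show ?thesis by simp
  qed
  have 5: "?a \<cdot> (\<iota> (N \<odot> X) \<otimes> \<epsilon>) \<cdot> ?c = \<iota> (N \<odot> X)"
  proof -
    have "?a \<cdot> (\<iota> (N \<odot> X) \<otimes> \<epsilon>) \<cdot> ?c = (\<mu> \<otimes> \<iota> X) \<cdot> (\<iota> N \<otimes> (\<psi> \<cdot> (\<iota> X \<otimes> \<epsilon>))) \<cdot> (\<mu> \<otimes> \<iota> (X \<odot> X)) \<cdot> (\<iota> N \<otimes> \<delta>)" by simp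
    also have "\<dots> = (\<mu> \<otimes> \<iota> X) \<cdot> (\<iota> N \<otimes> ((m \<otimes> \<iota> X) \<cdot> (\<iota> A \<otimes> (\<psi> \<cdot> (\<iota> X \<otimes> \<epsilon>))) \<cdot> \<delta>))"
      by (rule b) (simp_all add: hom_iff)
    also have "(m \<otimes> \<iota> X) \<cdot> (\<iota> A \<otimes> (\<psi> \<cdot> (\<iota> X \<otimes> \<epsilon>))) \<cdot> \<delta> = \<eta> \<otimes> \<iota> X"
      using cw' by simp
    also have "(\<mu> \<otimes> \<iota> X) \<cdot> (\<iota> N \<otimes> \<eta> \<otimes> \<iota> X) = (\<mu> \<cdot> (\<iota> N \<otimes> \<eta>)) \<otimes> \<iota> X" by simp
    finally show ?thesis unfolding right_modules_facts(4)[OF N] by simp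
  qed
  show ?thesis
    unfolding entwined_modules_def right_modules_def
    using 1 2 3 4 5 by (simp del: Comp_assoc_typed whisker_left_Comp whisker_right_Comp add: hom_iff)
qed

lemma cofree_module: 
  assumes cw: "cowreath C A m \<eta> X \<psi> \<delta> \<epsilon>" and N: "(N, \<mu>) \<in> right_modules C A m \<eta>"
  shows "(N \<odot> X, (\<mu> \<otimes> \<iota> X) \<cdot> (\<iota> N \<otimes> \<psi>)) \<in> right_modules C A m \<eta>"
  using cofree_entwined[OF assms] by (auto simp: entwined_modules_def)

lemma tens_slide:
  assumes "f \<in> hom C M N" "g \<in> hom C Y Y'"
  shows "(f \<otimes> \<iota> Y') \<cdot> (\<iota> M \<otimes> g) = (\<iota> N \<otimes> g) \<cdot> (f \<otimes> \<iota> Y)"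
  using assms by (auto simp: hom_iff slide)

lemma cofree_linear:
  assumes cw: "cowreath C A m \<eta> X \<psi> \<delta> \<epsilon>"
    and M: "(M, \<mu>) \<in> right_modules C A m \<eta>" and N: "(N, \<nu>) \<in> right_modules C A m \<eta>"
    and f: "f \<in> right_linear C A (M, \<mu>) (N, \<nu>)"
  shows "f \<otimes> \<iota> X \<in> right_linear C A (M \<odot> X, (\<mu> \<otimes> \<iota> X) \<cdot> (\<iota> M \<otimes> \<psi>)) (N \<odot> X, (\<nu> \<otimes> \<iota> X) \<cdot> (\<iota> N \<otimes> \<psi>))"
    and "((f \<otimes> \<iota> X) \<otimes> \<iota> X) \<cdot> (\<mu> \<otimes> \<iota> X \<otimes> \<iota> X) \<cdot> (\<iota> M \<otimes> \<delta>) = ((\<nu> \<otimes> \<iota> X \<otimes> \<iota> X) \<cdot> (\<iota> N \<otimes> \<delta>)) \<cdot> (f \<otimes> \<iota> X)"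
proof -
  note cw' = cw[unfolded cowreath_iff]
  have alg: "algebra C A m \<eta>" using cw' by blast
  note ty = algebra_facts[OF alg] right_modules_facts(1,2)[OF N] right_modules_facts(1,2)[OF M] 
  have ty2: "X \<in> Obj C" "\<psi> \<in> hom C (X \<odot> A) (A \<odot> X)" "\<delta> \<in> hom C X (A \<odot> X \<odot> X)" "\<epsilon> \<in> hom C X A" "f \<in> hom C M N"
    using cw' f by (auto simp: transfer_objs_def right_linear_def)
  note [simp] = ty[unfolded hom_iff] ty2[unfolded hom_iff]
  have l: "f \<cdot> \<mu> = \<nu> \<cdot> (f \<otimes> \<iota> A)" using f by (simp add: right_linear_def)
  have "(f \<otimes> \<iota> X) \<cdot> ((\<mu> \<otimes> \<iota> X) \<cdot> (\<iota> M \<otimes> \<psi>)) = ((f \<cdot> \<mu>) \<otimes> \<iota> X) \<cdot> (\<iota> M \<otimes> \<psi>)"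
    by simp
  also have "\<dots> = (\<nu> \<otimes> \<iota> X) \<cdot> ((f \<otimes> \<iota> (A \<odot> X)) \<cdot> (\<iota> M \<otimes> \<psi>))" unfolding l by simp
  also have "\<dots> = ((\<nu> \<otimes> \<iota> X) \<cdot> (\<iota> N \<otimes> \<psi>)) \<cdot> (f \<otimes> \<iota> X \<otimes> \<iota> A)"
    unfolding tens_slide[OF ty2(5,2)] by simp
  finally show "f \<otimes> \<iota> X \<in> right_linear C A (M \<odot> X, (\<mu> \<otimes> \<iota> X) \<cdot> (\<iota> M \<otimes> \<psi>)) (N \<odot> X, (\<nu> \<otimes> \<iota> X) \<cdot> (\<iota> N \<otimes> \<psi>))"
    by (simp add: right_linear_def hom_iff)
  have "((f \<otimes> \<iota> X) \<otimes> \<iota> X) \<cdot> (\<mu> \<otimes> \<iota> X \<otimes> \<iota> X) \<cdot> (\<iota> M \<otimes> \<delta>) = ((f \<cdot> \<mu>) \<otimes> \<iota> (X \<odot> X)) \<cdot> (\<iota> M \<otimes> \<delta>)"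
    by simp
  also have "\<dots> = (\<nu> \<otimes> \<iota> (X \<odot> X)) \<cdot> ((f \<otimes> \<iota> (A \<odot> X \<odot> X)) \<cdot> (\<iota> M \<otimes> \<delta>))" unfolding l by simp
  also have "\<dots> = ((\<nu> \<otimes> \<iota> X \<otimes> \<iota> X) \<cdot> (\<iota> N \<otimes> \<delta>)) \<cdot> (f \<otimes> \<iota> X)"
    unfolding tens_slide[OF ty2(5,3)] by simp
  finally show "((f \<otimes> \<iota> X) \<otimes> \<iota> X) \<cdot> (\<mu> \<otimes> \<iota> X \<otimes> \<iota> X) \<cdot> (\<iota> M \<otimes> \<delta>) = ((\<nu> \<otimes> \<iota> X \<otimes> \<iota> X) \<cdot> (\<iota> N \<otimes> \<delta>)) \<cdot> (f \<otimes> \<iota> X)" .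
qed

lemma forget_functor:
  assumes cw: "cowreath C A m \<eta> X \<psi> \<delta> \<epsilon>"
  shows "cat_functor (entwined_cat C A m \<eta> X \<psi> \<delta> \<epsilon>) (module_cat C A m \<eta>) forget_func"
proof -
  note cw' = cw[unfolded cowreath_iff]
  have *: "algebra C A m \<eta>" "X \<in> Obj C" using cw' by (auto simp: transfer_objs_def)
  show ?thesis
    apply (intro cat_functor.intro category_entwined_cat category_module_cat * cat_functor_axioms.intro)
    by (auto simp: entwined_cat_def module_cat_def entwined_modules_def split: if_splits)
qed

lemma cofree_functor:
  assumes cw: "cowreath C A m \<eta> X \<psi> \<delta> \<epsilon>"
  shows "cat_functor (module_cat C A m \<eta>) (entwined_cat C A m \<eta> X \<psi> \<delta> \<epsilon>) (cofree_func C X \<psi> \<delta>)"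
proof -
  note cw' = cw[unfolded cowreath_iff]
  have *[simp]: "algebra C A m \<eta>" "X \<in> Obj C" using cw' by (auto simp: transfer_objs_def)
  note [simp] = algebra_facts[OF *(1)]
  show ?thesis
  proof (intro cat_functor.intro category_entwined_cat category_module_cat * cat_functor_axioms.intro, goal_cases)
    case (1 N) then show ?case using cofree_entwined[OF cw]
      by (cases N) (auto simp: entwined_cat_def module_cat_def)
  next
    case (2 f M N)
    then show ?case using cofree_entwined[OF cw] cofree_linear[OF cw]
      by (cases M, cases N) (auto simp: entwined_cat_def module_cat_def image_iff split: if_splits)
  next
    case (3 N)
    then show ?case by (cases N) (auto simp: entwined_cat_def module_cat_def right_modules_def)
  next
    case (4 f M N g K)
    then show ?case
      by (cases M, cases N, cases K)
        (auto simp: entwined_cat_def module_cat_def right_linear_def hom_iff[of _ C] split: if_splits)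
  qed
qed

lemma forget_adjoint_cofree:
  assumes cw: "cowreath C A m \<eta> X \<psi> \<delta> \<epsilon>"
  shows "adjoint (entwined_cat C A m \<eta> X \<psi> \<delta> \<epsilon>) (module_cat C A m \<eta>) forget_func (cofree_func C X \<psi> \<delta>)"
proof -
  let ?E = "entwined_cat C A m \<eta> X \<psi> \<delta> \<epsilon>" and ?M = "module_cat C A m \<eta>"
  let ?F = forget_func and ?G = "cofree_func C X \<psi> \<delta>"
  note cw' = cw[unfolded cowreath_iff]
  have alg: "algebra C A m \<eta>" using cw' by blast
  note ty = algebra_facts[OF alg]
  have ty2: "X \<in> Obj C" "\<psi> \<in> hom C (X \<odot> A) (A \<odot> X)" "\<delta> \<in> hom C X (A \<odot> X \<odot> X)" "\<epsilon> \<in> hom C X A"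
    using cw' by (auto simp: transfer_objs_def)
  note [simp] = ty[unfolded hom_iff] ty2[unfolded hom_iff]
  define u where "u = restrict (\<lambda>(M, \<mu>, \<rho>). ((M, \<mu>, \<rho>), \<rho>, FO ?G (M, \<mu>))) (Obj ?E)"
  define c where "c = restrict (\<lambda>(N, \<mu>). (FO ?F (FO ?G (N, \<mu>)), \<mu> \<cdot> (\<iota> N \<otimes> \<epsilon>), (N, \<mu>))) (Obj ?M)"
  have u: "u \<in> Nat_Trans ?E ?E id_func (?G \<circ>\<^sub>F ?F)"
  proof -
    have "\<rho> \<in> right_linear C A (M, \<mu>) (M \<odot> X, (\<mu> \<otimes> \<iota> X) \<cdot> (\<iota> M \<otimes> \<psi>))"
      "(\<rho> \<otimes> \<iota> X) \<cdot> \<rho> = ((\<mu> \<otimes> \<iota> X \<otimes> \<iota> X) \<cdot> (\<iota> M \<otimes> \<delta>)) \<cdot> \<rho>" "(M, \<mu>) \<in> right_modules C A m \<eta>"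
      if "(M, \<mu>, \<rho>) \<in> entwined_modules C A m \<eta> X \<psi> \<delta> \<epsilon>" for M \<mu> \<rho>
      using that by (auto simp: entwined_modules_def right_linear_def hom_iff right_modules_def)
    then show ?thesis using cofree_entwined[OF cw]
      by (auto simp: Nat_Trans_def u_def entwined_cat_def image_iff)
  qed
  have cl: "\<mu> \<cdot> (\<iota> N \<otimes> \<epsilon>) \<in> right_linear C A (N \<odot> X, (\<mu> \<otimes> \<iota> X) \<cdot> (\<iota> N \<otimes> \<psi>)) (N, \<mu>)"
    if N: "(N, \<mu>) \<in> right_modules C A m \<eta>" for N \<mu>
  proof -
    note [simp] = right_modules_facts(1,2)[OF N, unfolded hom_iff]
    note b = module_comp[OF N ty(2,1)]
    have "(\<mu> \<cdot> (\<iota> N \<otimes> \<epsilon>)) \<cdot> ((\<mu> \<otimes> \<iota> X) \<cdot> (\<iota> N \<otimes> \<psi>)) = (\<mu> \<otimes> \<iota> \<one>) \<cdot> (\<iota> N \<otimes> \<epsilon>) \<cdot> (\<mu> \<otimes> \<iota> X) \<cdot> (\<iota> N \<otimes> \<psi>)" by simp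
    also have "\<dots> = (\<mu> \<otimes> \<iota> \<one>) \<cdot> (\<iota> N \<otimes> ((m \<otimes> \<iota> \<one>) \<cdot> (\<iota> A \<otimes> \<epsilon>) \<cdot> \<psi>))"
      by (rule b) (simp_all add: hom_iff)
    also have "(m \<otimes> \<iota> \<one>) \<cdot> (\<iota> A \<otimes> \<epsilon>) \<cdot> \<psi> = m \<cdot> (\<epsilon> \<otimes> \<iota> A)" using cw' by simp
    also have "(\<mu> \<otimes> \<iota> \<one>) \<cdot> (\<iota> N \<otimes> (m \<cdot> (\<epsilon> \<otimes> \<iota> A))) = (\<mu> \<cdot> (\<iota> N \<otimes> m)) \<cdot> (\<iota> N \<otimes> (\<epsilon> \<otimes> \<iota> A))" by simp
    also have "\<dots> = \<mu> \<cdot> ((\<mu> \<cdot> (\<iota> N \<otimes> \<epsilon>)) \<otimes> \<iota> A)"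
      unfolding right_modules_facts(3)[OF N, symmetric] by simp
    finally show ?thesis by (simp add: right_linear_def hom_iff)
  qed
  have cn: "(\<nu> \<cdot> (\<iota> N \<otimes> \<epsilon>)) \<cdot> (f \<otimes> \<iota> X) = f \<cdot> \<mu> \<cdot> (\<iota> M \<otimes> \<epsilon>)"
    if M: "(M, \<mu>) \<in> right_modules C A m \<eta>" and N: "(N, \<nu>) \<in> right_modules C A m \<eta>" 
    and f: "f \<in> right_linear C A (M, \<mu>) (N, \<nu>)" for M \<mu> N \<nu> f
  proof -
    note [simp] = right_modules_facts(1,2)[OF N, unfolded hom_iff] right_modules_facts(1,2)[OF M, unfolded hom_iff]
    have fh: "f \<in> hom C M N" and l: "f \<cdot> \<mu> = \<nu> \<cdot> (f \<otimes> \<iota> A)" using f by (auto simp: right_linear_def)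
    note [simp] = fh[unfolded hom_iff]
    have "(\<nu> \<cdot> (\<iota> N \<otimes> \<epsilon>)) \<cdot> (f \<otimes> \<iota> X) = \<nu> \<cdot> ((\<iota> N \<otimes> \<epsilon>) \<cdot> (f \<otimes> \<iota> X))" by simp
    also have "\<dots> = (\<nu> \<cdot> (f \<otimes> \<iota> A)) \<cdot> (\<iota> M \<otimes> \<epsilon>)" unfolding tens_slide[OF fh ty2(4), symmetric] by simp
    finally show ?thesis unfolding l[symmetric] by simp
  qed
  have c: "c \<in> Nat_Trans ?M ?M (?F \<circ>\<^sub>F ?G) id_func"
    using cofree_module[OF cw] cl cn
    by (auto simp: Nat_Trans_def c_def module_cat_def)
  have t1: "Comp ?M (c (FO ?F Y)) (FM ?F (u Y)) = Ide ?M (FO ?F Y)" if "Y \<in> Obj ?E" for Y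
    using that by (auto simp: entwined_modules_def right_modules_def hom_iff entwined_cat_def module_cat_def c_def u_def)
  have t2: "Comp ?E (FM ?G (c Y)) (u (FO ?G Y)) = Ide ?E (FO ?G Y)" if "Y \<in> Obj ?M" for Y
  proof -
    obtain N \<mu> where [simp]: "Y = (N, \<mu>)" by (cases Y)
    have N: "(N, \<mu>) \<in> right_modules C A m \<eta>" using that by (simp add: module_cat_def)
    note [simp] = right_modules_facts(1,2)[OF N, unfolded hom_iff]
    note b = module_comp[OF N ty(2,1)]
    have "((\<mu> \<cdot> (\<iota> N \<otimes> \<epsilon>)) \<otimes> \<iota> X) \<cdot> (\<mu> \<otimes> \<iota> X \<otimes> \<iota> X) \<cdot> (\<iota> N \<otimes> \<delta>)
       = (\<mu> \<otimes> \<iota> X) \<cdot> (\<iota> N \<otimes> (\<epsilon> \<otimes> \<iota> X)) \<cdot> (\<mu> \<otimes> \<iota> (X \<odot> X)) \<cdot> (\<iota> N \<otimes> \<delta>)" by simp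
    also have "\<dots> = (\<mu> \<otimes> \<iota> X) \<cdot> (\<iota> N \<otimes> ((m \<otimes> \<iota> X) \<cdot> (\<iota> A \<otimes> (\<epsilon> \<otimes> \<iota> X)) \<cdot> \<delta>))"
      by (rule b) (simp_all add: hom_iff)
    also have "(m \<otimes> \<iota> X) \<cdot> (\<iota> A \<otimes> (\<epsilon> \<otimes> \<iota> X)) \<cdot> \<delta> = \<eta> \<otimes> \<iota> X" using cw' by simp
    also have "(\<mu> \<otimes> \<iota> X) \<cdot> (\<iota> N \<otimes> \<eta> \<otimes> \<iota> X) = (\<mu> \<cdot> (\<iota> N \<otimes> \<eta>)) \<otimes> \<iota> X" by simp
    finally have "((\<mu> \<cdot> (\<iota> N \<otimes> \<epsilon>)) \<otimes> \<iota> X) \<cdot> (\<mu> \<otimes> \<iota> X \<otimes> \<iota> X) \<cdot> (\<iota> N \<otimes> \<delta>) = \<iota> (N \<odot> X)"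
      unfolding right_modules_facts(4)[OF N] by simp
    then show ?thesis using cofree_entwined[OF cw N] N
      by (simp add: entwined_cat_def module_cat_def c_def u_def)
  qed
  show ?thesis unfolding adjoint_def
    using forget_functor[OF cw] cofree_functor[OF cw] u c t1 t2 by blast
qed

end

end

theory Submission
  imports Defs
begin

text \<open>A point \<open>t : \<one> \<rightarrow> AX\<close> of \<open>(X, \<psi>)\<close> acts on every right module \<open>(N, \<mu>)\<close> by the natural map
  \<open>\<mu>X \<circ> Nt : N \<rightarrow> NX\<close>; the condition on \<open>t\<close> makes this map right linear. Conversely a natural
  \<open>\<theta>\<close> gives the point \<open>\<theta>\<^sub>A \<circ> \<eta>\<close>. Naturality with respect to the orbit maps
  \<open>\<mu> \<circ> hA : A \<rightarrow> N\<close>, for all \<open>h : \<one> \<rightarrow> N\<close>, together with the generator property of \<open>\<one>\<close>, yields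
  \<open>\<theta>\<^sub>N \<circ> \<mu> = \<mu>X \<circ> N\<theta>\<^sub>A\<close>, and evaluating at \<open>\<eta>\<close> shows that \<open>\<theta>\<close> is determined by its point.\<close>

context strict_monoidal_category begin

lemma right_linear_hom: "f \<in> right_linear C A (M, \<mu>) (N, \<nu>) \<Longrightarrow> f \<in> hom C M N"
  by (simp add: right_linear_def)

lemma regular_module: "algebra C A m \<eta> \<Longrightarrow> (A, m) \<in> right_modules C A m \<eta>"
  by (simp add: algebra_def right_modules_def)

text \<open>\<open>A\<close> is the free module on one generator: \<open>h\<close> slides past
  \<open>m\<close> by interchange, and associativity of the action does the rest. These maps are the
  test arrows at which naturality is evaluated later.\<close>

lemma orbit_map_linear:
  assumes alg: "algebra C A m \<eta>" and N: "(N, \<mu>) \<in> right_modules C A m \<eta>"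
    and h: "h \<in> hom C \<one> N"
  shows "\<mu> \<cdot> (h \<otimes> \<iota> A) \<in> right_linear C A (A, m) (N, \<mu>)"
proof -
  note [simp] = algebra_facts[OF alg, unfolded hom_iff]
    right_modules_facts(1,2)[OF N, unfolded hom_iff] h[unfolded hom_iff]
  have "(\<mu> \<cdot> (h \<otimes> \<iota> A)) \<cdot> m = \<mu> \<cdot> ((h \<otimes> \<iota> A) \<cdot> (\<iota> \<one> \<otimes> m))" by simp
  also have "\<dots> = (\<mu> \<cdot> (\<iota> N \<otimes> m)) \<cdot> (h \<otimes> \<iota> (A \<odot> A))"
    unfolding tens_slide[OF h algebra_facts(2)[OF alg]] by simp
  also have "\<dots> = \<mu> \<cdot> ((\<mu> \<cdot> (h \<otimes> \<iota> A)) \<otimes> \<iota> A)"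
    unfolding right_modules_facts(3)[OF N, symmetric] by simp
  finally show ?thesis by (simp add: right_linear_def hom_iff)
qed

text \<open>By \<open>module_comp\<close>, each side of the linearity equation becomes
  \<open>(\<mu> \<otimes> \<iota> X) \<cdot> (\<iota> N \<otimes> k)\<close> for some
  \<open>k : A \<rightarrow> AX\<close>, and the two maps \<open>k\<close> are precisely the two
  sides of \<open>eq\<close>.\<close>

lemma point_action_linear:
  assumes alg: "algebra C A m \<eta>" and X: "X \<in> Obj C" and \<psi>: "\<psi> \<in> hom C (X \<odot> A) (A \<odot> X)"
    and N: "(N, \<mu>) \<in> right_modules C A m \<eta>"
    and t: "t \<in> hom C \<one> (A \<odot> X)"
    and eq: "(m \<otimes> \<iota> X) \<cdot> (\<iota> A \<otimes> t) = (m \<otimes> \<iota> X) \<cdot> (\<iota> A \<otimes> \<psi>) \<cdot> (t \<otimes> \<iota> A)"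
  shows "(\<mu> \<otimes> \<iota> X) \<cdot> (\<iota> N \<otimes> t)
    \<in> right_linear C A (N, \<mu>) (N \<odot> X, (\<mu> \<otimes> \<iota> X) \<cdot> (\<iota> N \<otimes> \<psi>))"
proof -
  note ty = algebra_facts[OF alg]
  note [simp] = ty[unfolded hom_iff] X \<psi>[unfolded hom_iff] t[unfolded hom_iff]
    right_modules_facts(1,2)[OF N, unfolded hom_iff]
  note b = module_comp[OF N ty(2,1)]
  \<comment> \<open>Padding \<open>\<mu>\<close> with identities makes \<open>module_comp\<close>
    applicable, with middle object \<open>\<one>\<close> and first map
    \<open>\<iota> A\<close>.\<close>
  have "((\<mu> \<otimes> \<iota> X) \<cdot> (\<iota> N \<otimes> t)) \<cdot> \<mu> = (\<mu> \<otimes> \<iota> X) \<cdot> (\<iota> N \<otimes> t) \<cdot> (\<mu> \<otimes> \<iota> \<one>) \<cdot> (\<iota> N \<otimes> \<iota> A)"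
    by simp
  also have "\<dots> = (\<mu> \<otimes> \<iota> X) \<cdot> (\<iota> N \<otimes> ((m \<otimes> \<iota> X) \<cdot> (\<iota> A \<otimes> t) \<cdot> \<iota> A))"
    by (rule b) (simp_all add: hom_iff)
  also have "(m \<otimes> \<iota> X) \<cdot> (\<iota> A \<otimes> t) \<cdot> \<iota> A = (m \<otimes> \<iota> X) \<cdot> (\<iota> A \<otimes> \<psi>) \<cdot> (t \<otimes> \<iota> A)"
    using eq by simp
  also have "(\<mu> \<otimes> \<iota> X) \<cdot> (\<iota> N \<otimes> \<dots>)
      = (\<mu> \<otimes> \<iota> X) \<cdot> (\<iota> N \<otimes> \<psi>) \<cdot> (\<mu> \<otimes> \<iota> (X \<odot> A)) \<cdot> (\<iota> N \<otimes> (t \<otimes> \<iota> A))"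
    by (rule b[symmetric]) (simp_all add: hom_iff)
  finally show ?thesis by (simp add: right_linear_def hom_iff)
qed

lemma point_action_natural:
  assumes alg: "algebra C A m \<eta>" and X: "X \<in> Obj C"
    and M: "(M, \<mu>) \<in> right_modules C A m \<eta>" and N: "(N, \<nu>) \<in> right_modules C A m \<eta>"
    and f: "f \<in> right_linear C A (M, \<mu>) (N, \<nu>)" and t: "t \<in> hom C \<one> (A \<odot> X)"
  shows "((\<nu> \<otimes> \<iota> X) \<cdot> (\<iota> N \<otimes> t)) \<cdot> f = (f \<otimes> \<iota> X) \<cdot> (\<mu> \<otimes> \<iota> X) \<cdot> (\<iota> M \<otimes> t)"
proof -
  note fh = right_linear_hom[OF f]
  note [simp] = algebra_facts[OF alg, unfolded hom_iff] X t[unfolded hom_iff] fh[unfolded hom_iff]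
    right_modules_facts(1,2)[OF M, unfolded hom_iff] right_modules_facts(1,2)[OF N, unfolded hom_iff]
  have l: "f \<cdot> \<mu> = \<nu> \<cdot> (f \<otimes> \<iota> A)" using f by (simp add: right_linear_def)
  have "((\<nu> \<otimes> \<iota> X) \<cdot> (\<iota> N \<otimes> t)) \<cdot> f = (\<nu> \<otimes> \<iota> X) \<cdot> ((\<iota> N \<otimes> t) \<cdot> (f \<otimes> \<iota> \<one>))" by simp
  also have "\<dots> = ((\<nu> \<cdot> (f \<otimes> \<iota> A)) \<otimes> \<iota> X) \<cdot> (\<iota> M \<otimes> t)"
    unfolding tens_slide[OF fh t, symmetric] by simp
  also have "\<dots> = (f \<otimes> \<iota> X) \<cdot> (\<mu> \<otimes> \<iota> X) \<cdot> (\<iota> M \<otimes> t)"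
    unfolding l[symmetric] by simp
  finally show ?thesis .
qed

text \<open>The action on the regular module, evaluated at the unit of \<open>A\<close>, gives back
  the point. This is one of the two inverse laws of the bijection.\<close>

lemma point_action_unit:
  assumes alg: "algebra C A m \<eta>" and X: "X \<in> Obj C" and t: "t \<in> hom C \<one> (A \<odot> X)"
  shows "((m \<otimes> \<iota> X) \<cdot> (\<iota> A \<otimes> t)) \<cdot> \<eta> = t"
proof -
  note ty = algebra_facts[OF alg]
  note [simp] = ty[unfolded hom_iff] X t[unfolded hom_iff]
  have u: "m \<cdot> (\<eta> \<otimes> \<iota> A) = \<iota> A" using alg by (simp add: algebra_def)
  have "((m \<otimes> \<iota> X) \<cdot> (\<iota> A \<otimes> t)) \<cdot> \<eta> = (m \<otimes> \<iota> X) \<cdot> ((\<iota> A \<otimes> t) \<cdot> (\<eta> \<otimes> \<iota> \<one>))" by simp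
  also have "\<dots> = ((m \<cdot> (\<eta> \<otimes> \<iota> A)) \<otimes> \<iota> X) \<cdot> t"
    unfolding tens_slide[OF ty(3) t, symmetric] by simp
  also have "\<dots> = t" unfolding u by simp
  finally show ?thesis .
qed

text \<open>Here \<open>a\<close> and \<open>b\<close> stand for the components of a natural
  transformation at \<open>A\<close> and at \<open>N\<close>, and \<open>nat\<close> is its
  naturality at all orbit maps. After interchange, \<open>nat\<close> compares two maps
  \<open>NA \<rightarrow> NX\<close> precomposed with \<open>h \<otimes> \<iota> A\<close>, which is
  the form that the generator property cancels.\<close>

lemma orbit_natural_imp_point_action:
  assumes gen: "left_tensor_generator C \<one>"
    and alg: "algebra C A m \<eta>" and X: "X \<in> Obj C" and N: "(N, \<mu>) \<in> right_modules C A m \<eta>"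
    and a: "a \<in> hom C A (A \<odot> X)" and b: "b \<in> hom C N (N \<odot> X)"
    and nat: "\<And>h. h \<in> hom C \<one> N \<Longrightarrow> b \<cdot> \<mu> \<cdot> (h \<otimes> \<iota> A) = ((\<mu> \<cdot> (h \<otimes> \<iota> A)) \<otimes> \<iota> X) \<cdot> a"
  shows "b = (\<mu> \<otimes> \<iota> X) \<cdot> (\<iota> N \<otimes> (a \<cdot> \<eta>))"
proof -
  note [simp] = algebra_facts[OF alg, unfolded hom_iff] X a[unfolded hom_iff] b[unfolded hom_iff]
    right_modules_facts(1,2)[OF N, unfolded hom_iff]
  have "(b \<cdot> \<mu>) \<cdot> (h \<otimes> \<iota> A) = ((\<mu> \<otimes> \<iota> X) \<cdot> (\<iota> N \<otimes> a)) \<cdot> (h \<otimes> \<iota> A)" if h: "h \<in> hom C \<one> N" for h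
  proof -
    note [simp] = h[unfolded hom_iff]
    have "(b \<cdot> \<mu>) \<cdot> (h \<otimes> \<iota> A) = (\<mu> \<otimes> \<iota> X) \<cdot> ((h \<otimes> \<iota> (A \<odot> X)) \<cdot> (\<iota> \<one> \<otimes> a))"
      using nat[OF h] by simp
    also have "\<dots> = ((\<mu> \<otimes> \<iota> X) \<cdot> (\<iota> N \<otimes> a)) \<cdot> (h \<otimes> \<iota> A)"
      unfolding tens_slide[OF h a] by simp
    finally show ?thesis .
  qed
  moreover have "b \<cdot> \<mu> \<in> hom C (N \<odot> A) (N \<odot> X)"
    "(\<mu> \<otimes> \<iota> X) \<cdot> (\<iota> N \<otimes> a) \<in> hom C (N \<odot> A) (N \<odot> X)" "N \<in> Obj C" "A \<in> Obj C" "N \<odot> X \<in> Obj C"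
    by (simp_all add: hom_iff)
  \<comment> \<open>The generator property is used with \<open>Y = N\<close>, \<open>Z = A\<close>
    and \<open>W = N \<odot> X\<close>.\<close>
  ultimately have e: "b \<cdot> \<mu> = (\<mu> \<otimes> \<iota> X) \<cdot> (\<iota> N \<otimes> a)"
    using gen unfolding left_tensor_generator_def by blast
  \<comment> \<open>The unit law inserts \<open>\<mu>\<close> after \<open>b\<close>, so that
    \<open>e\<close> can be applied.\<close>
  have "b = b \<cdot> (\<mu> \<cdot> (\<iota> N \<otimes> \<eta>))" unfolding right_modules_facts(4)[OF N] by simp
  also have "\<dots> = (b \<cdot> \<mu>) \<cdot> (\<iota> N \<otimes> \<eta>)" by simp
  also have "\<dots> = (\<mu> \<otimes> \<iota> X) \<cdot> (\<iota> N \<otimes> (a \<cdot> \<eta>))" unfolding e by simp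
  finally show ?thesis .
qed

text \<open>A linear map out of the free module \<open>A\<close> is determined by its value at
  \<open>\<eta>\<close>. For the twisted action on \<open>A \<odot> X\<close>, this expresses
  \<open>a\<close> as the right-hand side of the transfer condition for the point
  \<open>a \<cdot> \<eta>\<close>.\<close>

lemma linear_point_condition:
  assumes alg: "algebra C A m \<eta>" and X: "X \<in> Obj C" and \<psi>: "\<psi> \<in> hom C (X \<odot> A) (A \<odot> X)"
    and a: "a \<in> right_linear C A (A, m) (A \<odot> X, (m \<otimes> \<iota> X) \<cdot> (\<iota> A \<otimes> \<psi>))"
  shows "a = (m \<otimes> \<iota> X) \<cdot> (\<iota> A \<otimes> \<psi>) \<cdot> ((a \<cdot> \<eta>) \<otimes> \<iota> A)"
proof -
  note [simp] = algebra_facts[OF alg, unfolded hom_iff] X \<psi>[unfolded hom_iff]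
    right_linear_hom[OF a, unfolded hom_iff]
  have u: "m \<cdot> (\<eta> \<otimes> \<iota> A) = \<iota> A" using alg by (simp add: algebra_def)
  have l: "a \<cdot> m = ((m \<otimes> \<iota> X) \<cdot> (\<iota> A \<otimes> \<psi>)) \<cdot> (a \<otimes> \<iota> A)" using a by (simp add: right_linear_def)
  have "a = a \<cdot> (m \<cdot> (\<eta> \<otimes> \<iota> A))" unfolding u by simp
  also have "\<dots> = (a \<cdot> m) \<cdot> (\<eta> \<otimes> \<iota> A)" by simp
  also have "\<dots> = (m \<otimes> \<iota> X) \<cdot> (\<iota> A \<otimes> \<psi>) \<cdot> ((a \<cdot> \<eta>) \<otimes> \<iota> A)" unfolding l by simp
  finally show ?thesis .
qed

text \<open>Arrows of \<open>module_cat\<close> are triples, so a component of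
  \<open>\<theta>\<close> carries its source and target. This exposes the underlying morphism
  \<open>b\<close> of \<open>C\<close>; \<open>c N \<mu>\<close> is the module left when the
  coaction of the cofree object is forgotten.\<close>

lemma Nat_Trans_cofree_component:
  fixes X \<psi> \<delta>
  defines "c \<equiv> \<lambda>N \<mu>. (N \<odot> X, (\<mu> \<otimes> \<iota> X) \<cdot> (\<iota> N \<otimes> \<psi>))"
  assumes \<theta>: "\<theta> \<in> Nat_Trans (module_cat C A m \<eta>) (module_cat C A m \<eta>)
      id_func (forget_func \<circ>\<^sub>F cofree_func C X \<psi> \<delta>)"
    and N: "(N, \<mu>) \<in> right_modules C A m \<eta>"
  obtains b where "\<theta> (N, \<mu>) = ((N, \<mu>), b, c N \<mu>)" "b \<in> right_linear C A (N, \<mu>) (c N \<mu>)"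
proof -
  let ?M = "module_cat C A m \<eta>"
  have "\<forall>S \<in> Obj ?M. \<theta> S \<in> hom ?M S (FO (forget_func \<circ>\<^sub>F cofree_func C X \<psi> \<delta>) S)"
    using \<theta> by (simp add: Nat_Trans_def)
  moreover have "(N, \<mu>) \<in> Obj ?M" using N by (simp add: module_cat_def)
  ultimately have "\<theta> (N, \<mu>) \<in> hom ?M (N, \<mu>) (c N \<mu>)"
    by (auto simp: c_def simp del: cat_of_homs_hom)
  then show ?thesis using that by (auto simp: module_cat_def split: if_splits)
qed

lemma Nat_Trans_cofree_natural:
  assumes \<theta>: "\<theta> \<in> Nat_Trans (module_cat C A m \<eta>) (module_cat C A m \<eta>)
      id_func (forget_func \<circ>\<^sub>F cofree_func C X \<psi> \<delta>)"
    and M: "(M, \<mu>) \<in> right_modules C A m \<eta>" and N: "(N, \<nu>) \<in> right_modules C A m \<eta>"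
    and f: "f \<in> right_linear C A (M, \<mu>) (N, \<nu>)"
  shows "fst (snd (\<theta> (N, \<nu>))) \<cdot> f = (f \<otimes> \<iota> X) \<cdot> fst (snd (\<theta> (M, \<mu>)))"
proof -
  let ?M = "module_cat C A m \<eta>"
  obtain a where a: "\<theta> (M, \<mu>) = ((M, \<mu>), a, (M \<odot> X, (\<mu> \<otimes> \<iota> X) \<cdot> (\<iota> M \<otimes> \<psi>)))"
    using Nat_Trans_cofree_component[OF \<theta> M] by blast
  obtain b where b: "\<theta> (N, \<nu>) = ((N, \<nu>), b, (N \<odot> X, (\<nu> \<otimes> \<iota> X) \<cdot> (\<iota> N \<otimes> \<psi>)))"
    using Nat_Trans_cofree_component[OF \<theta> N] by blast
  have obj: "((M, \<mu>), f, (N, \<nu>)) \<in> hom ?M (M, \<mu>) (N, \<nu>)"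
      "(M, \<mu>) \<in> Obj ?M" "(N, \<nu>) \<in> Obj ?M"
    using M N f by (auto simp: module_cat_def)
  have "\<forall>S \<in> Obj ?M. \<forall>S' \<in> Obj ?M. \<forall>g \<in> hom ?M S S'. Comp ?M (\<theta> S') g
      = Comp ?M (FM (forget_func \<circ>\<^sub>F cofree_func C X \<psi> \<delta>) g) (\<theta> S)"
    using \<theta> by (simp add: Nat_Trans_def)
  from this[rule_format, OF obj(2,3,1)] show ?thesis unfolding a b by (simp add: module_cat_def)
qed

text \<open>Naturality at the orbit maps \<open>A \<rightarrow> N\<close> supplies the hypothesis of
  \<open>orbit_natural_imp_point_action\<close>. Hence the point of \<open>\<theta>\<close>
  determines every component, including the one at \<open>A\<close> itself.\<close>

lemma Nat_Trans_cofree_eq_point_action: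
  assumes gen: "left_tensor_generator C \<one>"
    and alg: "algebra C A m \<eta>" and X: "X \<in> Obj C"
    and \<theta>: "\<theta> \<in> Nat_Trans (module_cat C A m \<eta>) (module_cat C A m \<eta>)
      id_func (forget_func \<circ>\<^sub>F cofree_func C X \<psi> \<delta>)"
    and N: "(N, \<mu>) \<in> right_modules C A m \<eta>"
  shows "\<theta> (N, \<mu>) = ((N, \<mu>), (\<mu> \<otimes> \<iota> X) \<cdot> (\<iota> N \<otimes> (fst (snd (\<theta> (A, m))) \<cdot> \<eta>)),
    (N \<odot> X, (\<mu> \<otimes> \<iota> X) \<cdot> (\<iota> N \<otimes> \<psi>)))"
proof -
  note A = regular_module[OF alg]
  obtain a where a: "\<theta> (A, m) = ((A, m), a, (A \<odot> X, (m \<otimes> \<iota> X) \<cdot> (\<iota> A \<otimes> \<psi>)))"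
    "a \<in> right_linear C A (A, m) (A \<odot> X, (m \<otimes> \<iota> X) \<cdot> (\<iota> A \<otimes> \<psi>))"
    using Nat_Trans_cofree_component[OF \<theta> A] by blast
  obtain b where b: "\<theta> (N, \<mu>) = ((N, \<mu>), b, (N \<odot> X, (\<mu> \<otimes> \<iota> X) \<cdot> (\<iota> N \<otimes> \<psi>)))"
    "b \<in> right_linear C A (N, \<mu>) (N \<odot> X, (\<mu> \<otimes> \<iota> X) \<cdot> (\<iota> N \<otimes> \<psi>))"
    using Nat_Trans_cofree_component[OF \<theta> N] by blast
  have "b \<cdot> \<mu> \<cdot> (h \<otimes> \<iota> A) = ((\<mu> \<cdot> (h \<otimes> \<iota> A)) \<otimes> \<iota> X) \<cdot> a" if "h \<in> hom C \<one> N" for h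
    using Nat_Trans_cofree_natural[OF \<theta> A N orbit_map_linear[OF alg N that]] a b by simp
  from orbit_natural_imp_point_action[OF gen alg X N a(2)[THEN right_linear_hom]
      b(2)[THEN right_linear_hom] this]
  show ?thesis using a b by simp
qed

lemma point_action_Nat_Trans:
  assumes alg: "algebra C A m \<eta>" and X: "X \<in> Obj C"
    and cofree: "\<And>N \<mu>. (N, \<mu>) \<in> right_modules C A m \<eta>
      \<Longrightarrow> (N \<odot> X, (\<mu> \<otimes> \<iota> X) \<cdot> (\<iota> N \<otimes> \<psi>)) \<in> right_modules C A m \<eta>"
    and \<psi>: "\<psi> \<in> hom C (X \<odot> A) (A \<odot> X)"
    and t: "t \<in> hom C \<one> (A \<odot> X)"
    and eq: "(m \<otimes> \<iota> X) \<cdot> (\<iota> A \<otimes> t) = (m \<otimes> \<iota> X) \<cdot> (\<iota> A \<otimes> \<psi>) \<cdot> (t \<otimes> \<iota> A)"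
  shows "restrict (\<lambda>(N, \<mu>). ((N, \<mu>), (\<mu> \<otimes> \<iota> X) \<cdot> (\<iota> N \<otimes> t),
      (N \<odot> X, (\<mu> \<otimes> \<iota> X) \<cdot> (\<iota> N \<otimes> \<psi>)))) (right_modules C A m \<eta>)
    \<in> Nat_Trans (module_cat C A m \<eta>) (module_cat C A m \<eta>)
      id_func (forget_func \<circ>\<^sub>F cofree_func C X \<psi> \<delta>)"
  using cofree point_action_linear[OF alg X \<psi> _ t eq] point_action_natural[OF alg X _ _ _ t]
  by (auto simp: Nat_Trans_def module_cat_def)

lemma bij_betw_Nat_Trans_transfer_hom:
  assumes cw: "cowreath C A m \<eta> X \<psi> \<delta> \<epsilon>" and gen: "left_tensor_generator C \<one>"
  defines "T \<equiv> transfer_cat C A m \<eta>"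
  shows "bij_betw (\<lambda>\<theta>. (Unit T, fst (snd (\<theta> (A, m))) \<cdot> \<eta>, (X, \<psi>)))
    (Nat_Trans (module_cat C A m \<eta>) (module_cat C A m \<eta>)
       id_func (forget_func \<circ>\<^sub>F cofree_func C X \<psi> \<delta>))
    (hom T (Unit T) (X, \<psi>))"
    (is "bij_betw ?\<Phi> ?Nat _")
proof -
  let ?R = "right_modules C A m \<eta>"
  have alg: "algebra C A m \<eta>" and tr: "(X, \<psi>) \<in> transfer_objs C A m \<eta>"
    using cw by (simp_all add: cowreath_iff)
  then have X: "X \<in> Obj C" and \<psi>: "\<psi> \<in> hom C (X \<odot> A) (A \<odot> X)"
    by (auto simp: transfer_objs_def)
  note A = regular_module[OF alg]
  \<comment> \<open>The candidate inverse. Restricting to modules matches the extensionality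
    demanded by \<open>Nat_Trans\<close>.\<close>
  define act where "act = (\<lambda>t. restrict (\<lambda>(N, \<mu>). ((N, \<mu>), (\<mu> \<otimes> \<iota> X) \<cdot> (\<iota> N \<otimes> t),
      (N \<odot> X, (\<mu> \<otimes> \<iota> X) \<cdot> (\<iota> N \<otimes> \<psi>)))) ?R)"
  define P where "P = {t \<in> hom C \<one> (A \<odot> X).
    (m \<otimes> \<iota> X) \<cdot> (\<iota> A \<otimes> t) = (m \<otimes> \<iota> X) \<cdot> (\<iota> A \<otimes> \<psi>) \<cdot> (t \<otimes> \<iota> A)}"
  have hom_T: "hom T (Unit T) (X, \<psi>) = (\<lambda>t. (Unit T, t, (X, \<psi>))) ` P"
    unfolding T_def P_def by (rule transfer_hom_unit[OF alg tr])
  \<comment> \<open>On modules the two families agree because \<open>\<theta>\<close> is the action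
    of its point; elsewhere both are \<open>undefined\<close>.\<close>
  have act_point: "act (fst (snd (\<theta> (A, m))) \<cdot> \<eta>) = \<theta>" if \<theta>: "\<theta> \<in> ?Nat" for \<theta>
  proof (rule extensionalityI)
    show "\<theta> \<in> extensional ?R" using \<theta> by (simp add: Nat_Trans_def module_cat_def)
  qed (auto simp: act_def Nat_Trans_cofree_eq_point_action[OF gen alg X \<theta>])
  have point_P: "fst (snd (\<theta> (A, m))) \<cdot> \<eta> \<in> P" if \<theta>: "\<theta> \<in> ?Nat" for \<theta>
  proof -
    obtain a where a: "\<theta> (A, m) = ((A, m), a, (A \<odot> X, (m \<otimes> \<iota> X) \<cdot> (\<iota> A \<otimes> \<psi>)))"
      "a \<in> right_linear C A (A, m) (A \<odot> X, (m \<otimes> \<iota> X) \<cdot> (\<iota> A \<otimes> \<psi>))"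
      using Nat_Trans_cofree_component[OF \<theta> A] by blast
    \<comment> \<open>The component at \<open>A\<close> has two expressions: this one comes from the
      generator property, the other from linearity through \<open>linear_point_condition\<close>.
      Equating them is the transfer condition for \<open>a \<cdot> \<eta>\<close>.\<close>
    have "a = (m \<otimes> \<iota> X) \<cdot> (\<iota> A \<otimes> (a \<cdot> \<eta>))"
      using Nat_Trans_cofree_eq_point_action[OF gen alg X \<theta> A] a(1) by simp
    moreover have "a \<cdot> \<eta> \<in> hom C \<one> (A \<odot> X)"
      using algebra_facts(3)[OF alg] a(2)[THEN right_linear_hom] by (rule Comp_hom)
    ultimately show ?thesis
      using linear_point_condition[OF alg X \<psi> a(2)] a(1) by (simp add: P_def)
  qed
  have act_Nat: "act t \<in> ?Nat" if "t \<in> P" for t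
    using point_action_Nat_Trans[OF alg X cofree_module[OF cw] \<psi>] that
    by (simp add: act_def P_def)
  have point_act: "fst (snd (act t (A, m))) \<cdot> \<eta> = t" if "t \<in> P" for t
    using point_action_unit[OF alg X, of t] A that by (simp add: act_def P_def)
  show ?thesis
    \<comment> \<open>The inverse strips source and target from an arrow of \<open>T\<close> and
      lets the remaining point act.\<close>
    by (rule bij_betw_byWitness[where f' = "\<lambda>s. act (fst (snd s))"])
      (use act_point point_P act_Nat point_act in \<open>auto simp: hom_T\<close>)
qed

end

theorem proposition4p6:
  fixes C :: "('o, 'm) moncat"
    and A X :: 'o
    and m \<eta> \<psi> \<delta> \<epsilon> :: 'm
  assumes "strict_monoidal_category C"
    and "cowreath C A m \<eta> X \<psi> \<delta> \<epsilon>"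
    and "left_tensor_generator C (Unit C)"
  shows "\<exists>\<Phi>. bij_betw \<Phi>
    (Nat_Trans (module_cat C A m \<eta>) (module_cat C A m \<eta>)
       id_func (forget_func \<circ>\<^sub>F cofree_func C X \<psi> \<delta>))
    (hom (transfer_cat C A m \<eta>) (Unit (transfer_cat C A m \<eta>)) (X, \<psi>))"
  using strict_monoidal_category.bij_betw_Nat_Trans_transfer_hom[OF assms] by blast

end
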